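(* There exists $\varepsilon>0$, with corresponding disk $u_\varepsilon=\{z\in\mathbb{C}:|z|<\varepsilon\}$ and region $\Omega_-$ as in the context, such that for $z\in\Omega_-\setminus u_\varepsilon$ $$\pi_m(z)=\frac{(1+z)^{\frac12}}{z^{\frac12}}\,(1+z)^m\left(1-\frac{\sqrt{2}\,i}{(1-z^2)^m(1-z)^{\frac12}(1+z)^{\frac12}}+\mathcal{O}\left(\frac1m\right)\right),$$ where the $\mathcal{O}(1/m)$ term is uniform in $z\in\Omega_-\setminus u_\varepsilon$; that is, it is a function $r(m,z)$ for which there are a constant $C>0$ and an integer $M>0$ with $|r(m,z)|\le C/m$ for all $m\ge M$ and all $z\in\Omega_-\setminus u_\varepsilon$.
   Context: **Polynomials.** For an integer $m\ge 1$ let $$P_m(z)=P_m^{(m+\frac12,-m-\frac12)}(z)=2^{-m}\sum_{k=0}^m\binom{2m+\frac12}{m-k}\binom{-\frac12}{k}(z-1)^k(z+1)^{m-k}$$ (generalized binomial coefficients), which is the Jacobi polynomial $P_m^{(\alpha,\beta)}$ with $\alpha=m+\frac12$, $\beta=-m-\frac12$. Let $\pi_m(z)=P_m(z)/\kappa_m$ with $\kappa_m=2^{-m}\binom{2m}{m}$, so that $\pi_m$ is monic of degree $m$. **Branches.** The square roots are $$(1+z)^{\frac12}=|1+z|^{\frac12}e^{i\theta/2},\quad \theta=\mathrm{Arg}(z+1)\in[0,2\pi),$$ $$(1-z)^{\frac12}=|1-z|^{\frac12}e^{i(\phi+\pi)/2},\quad \phi=\mathrm{Arg}(z-1)\in[0,2\pi),$$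 $$z^{\frac12}=|z|^{\frac12}e^{i\,\mathrm{Arg}(z)/2},\quad \mathrm{Arg}(z)\in[0,2\pi).$$ **Region.** Let $\Sigma_{-1}=\{z:|1-z^2|=1,\ \mathrm{Re}\,z\le 0\}$, a simple closed curve through the origin encircling $-1$. For small $\varepsilon>0$ let $\Sigma_{1/r}$ be a fixed (independent of $m$) simple closed curve consisting of the segment $[-i\varepsilon,i\varepsilon]$ of the imaginary axis together with a simple differentiable arc in the open left half-plane joining the endpoints of this segment, such that $\Sigma_{-1}\setminus\{0\}$ lies inside $\Sigma_{1/r}$ and this arc stays at a positive distance from $\Sigma_{-1}$. Then $\Omega_-$ is the open region between $\Sigma_{-1}$ and $\Sigma_{1/r}$, i.e. the set of points inside $\Sigma_{1/r}$ and outside $\Sigma_{-1}$. *)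

theory Defs
  imports "HOL-Analysis.Analysis"
begin

text \<open>
  The Jacobi polynomial with parameters \<open>\<alpha> = m + 1/2\<close> and \<open>\<beta> = -m - 1/2\<close>, so that
  \<open>m + \<alpha> = 2 m + 1/2\<close> and \<open>m + \<beta> = -1/2\<close>.
\<close>

definition jacobi_P :: "nat \<Rightarrow> complex \<Rightarrow> complex" where
  "jacobi_P m z = (1 / 2 ^ m) *
     (\<Sum>k = 0..m. ((2 * of_nat m + 1/2) gchoose (m - k)) * ((- 1/2) gchoose k)
        * (z - 1) ^ k * (z + 1) ^ (m - k))"

definition kappa :: "nat \<Rightarrow> complex" where
  "kappa m = (1 / 2 ^ m) * of_nat ((2 * m) choose m)"

definition monic_P :: "nat \<Rightarrow> complex \<Rightarrow> complex" where
  "monic_P m z = jacobi_P m z / kappa m"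

text \<open>
  The square roots use \<^const>\<open>Arg2pi\<close>, the argument in \<open>[0, 2\<pi>)\<close>, instead of the
  principal one.  In \<open>sqrt_1m\<close> the argument of \<open>z - 1\<close> is taken and then shifted by \<open>\<pi>\<close>.
\<close>

definition sqrt_z :: "complex \<Rightarrow> complex" where
  "sqrt_z z = of_real (sqrt (cmod z)) * exp (\<i> * of_real (Arg2pi z / 2))"

definition sqrt_1p :: "complex \<Rightarrow> complex" where
  "sqrt_1p z = of_real (sqrt (cmod (1 + z))) * exp (\<i> * of_real (Arg2pi (z + 1) / 2))"

definition sqrt_1m :: "complex \<Rightarrow> complex" where
  "sqrt_1m z = of_real (sqrt (cmod (1 - z))) * exp (\<i> * of_real ((Arg2pi (z - 1) + pi) / 2))"

definition Sigma_m1 :: "complex set" where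
  "Sigma_m1 = {z. cmod (1 - z\<^sup>2) = 1 \<and> Re z \<le> 0}"

definition Sigma_r :: "real \<Rightarrow> (real \<Rightarrow> complex) \<Rightarrow> complex set" where
  "Sigma_r \<epsilon> g = closed_segment (- \<i> * of_real \<epsilon>) (\<i> * of_real \<epsilon>) \<union> path_image g"

text \<open>
  \<open>g\<close> is an arc that completes the segment \<open>[-i\<epsilon>, i\<epsilon>]\<close> to an admissible outer curve.
  Apart from its two endpoints it lies in the open left half-plane, hence it meets the
  segment only there and \<open>Sigma_r \<epsilon> g\<close> is a simple closed curve.
\<close>

definition admissible_arc :: "real \<Rightarrow> (real \<Rightarrow> complex) \<Rightarrow> bool" where
  "admissible_arc \<epsilon> g \<longleftrightarrow>
     arc g \<and> g differentiable_on {0..1} \<and>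
     pathstart g = \<i> * of_real \<epsilon> \<and> pathfinish g = - \<i> * of_real \<epsilon> \<and>
     (\<forall>t\<in>{0<..<1}. Re (g t) < 0) \<and>
     Sigma_m1 - {0} \<subseteq> inside (Sigma_r \<epsilon> g) \<and>
     (\<exists>d>0. \<forall>w\<in>path_image g. \<forall>s\<in>Sigma_m1. d \<le> dist w s)"

definition Omega_minus :: "real \<Rightarrow> (real \<Rightarrow> complex) \<Rightarrow> complex set" where
  "Omega_minus \<epsilon> g = inside (Sigma_r \<epsilon> g) \<inter> outside Sigma_m1"

end

theory Submission
  imports Defs "HOL-Complex_Analysis.Complex_Analysis"
begin

text \<open>
  Put \<open>p = - z\<close> and \<open>b = 1 - z\<^sup>2 = 1 - p\<^sup>2\<close>.  In the region \<open>Re p > 0\<close> and \<open>\<bar>b\<bar> > 1\<close>,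
  and \<open>\<bar>p\<bar>\<close> stays between two positive constants.  The polynomial is a coefficient:
  \<open>2\<^sup>m P\<^sub>m(z) / (1 + z)\<^sup>m\<close> is the \<open>m\<close>-th coefficient in \<open>w\<close> of
  \<open>(1 + w) powr (2m + 1/2) * (1 + \<zeta> w) powr (-1/2)\<close> with \<open>\<zeta> = (z - 1) / (z + 1)\<close>.  Lagrange inversion with
  \<open>x = 4 w / (1 + w)\<^sup>2\<close> removes the \<open>m\<close>-dependence of this function: with
  \<open>c\<^sub>m = (2m choose m) / 4\<^sup>m\<close>, the numbers \<open>c\<^sub>m \<pi>\<^sub>m(z) / (1 + z)\<^sup>m\<close> are the Taylor coefficients of the single
  algebraic function
  \<open>G(x) = sqrt (p + sqrt (1 - x)) / (sqrt (1 + p) * sqrt (1 - x) * sqrt (1 - x / b))\<close>,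
  which is holomorphic in the unit disc (\<open>jacobi_sum_eq_gen_coefficient\<close>).

  The singularities that matter are \<open>x = 1\<close> and \<open>x = b\<close>, both outside the open disc, and near each of them
  \<open>G\<close> behaves like a constant times an inverse square root.  Since \<open>1 / sqrt (1 - x / b)\<close> has the
  coefficients \<open>c\<^sub>m / b\<^sup>m\<close>, the two inverse square roots contribute exactly the main term and the
  term with \<open>(1 - z\<^sup>2)\<^sup>-\<^sup>m\<close> of the theorem (\<open>monic_P_expansion\<close>).

  What is left of \<open>G\<close> is an algebraic expression in which neither \<open>sqrt (1 - x)\<close> nor \<open>sqrt (1 - x / b)\<close> is a divisor
  (\<open>gen_decomposition\<close>), so its second derivative is bounded by the power \<open>-3/2\<close> of
  the distances to the singularities (\<open>tame_gen_rem\<close>).  Cauchy's formula on the circle of radius \<open>1 - 1/m\<close>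
  turns this into coefficients of size \<open>m powr (-3/2)\<close> (\<open>coefficient_bound_by_second_derivative\<close>), and the
  division by \<open>c\<^sub>m \<ge> 1 / (2 sqrt m)\<close> leaves \<open>O(1/m)\<close>.  All constants depend only on the bounds for \<open>\<bar>p\<bar>\<close>; the
  lower bound enters because \<open>\<bar>1 - b\<bar> = \<bar>p\<bar>\<^sup>2\<close> separates the two singularities.
\<close>

section \<open>Lagrange inversion for the coefficient sum\<close>

lemma fps_eq_if_squares_eq:
  fixes a b :: "'a :: field_char_0 fps"
  assumes "a ^ 2 = b ^ 2" "fps_nth a 0 = 1" "fps_nth b 0 = 1"
  shows "a = b"
proof -
  have "a = b \<or> a = - b"
    using assms(1) by (simp add: power2_eq_iff)
  moreover have "a \<noteq> - b"
  proof
    assume "a = - b"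
    then have "fps_nth a 0 = - fps_nth b 0" by simp
    with assms show False by simp
  qed
  ultimately show ?thesis by blast
qed

text \<open>
  For \<open>j > 0\<close> the coefficient is \<open>((2j - 1) choose j) - ((2j - 1) choose (j - 1))\<close>, which vanishes by symmetry.
\<close>

lemma fps_binomial_ballot_nth:
  "fps_nth (fps_binomial (2 * of_nat j - 1) * (1 - fps_X) :: 'a :: field_char_0 fps) j
     = (if j = 0 then 1 else 0)"
proof (cases j)
  case (Suc i)
  have n: "(2 * of_nat j - 1 :: 'a) = of_nat (2 * i + 1)"
    using Suc by simp
  have "fps_nth (fps_binomial (2 * of_nat j - 1) * (1 - fps_X) :: 'a fps) j
      = of_nat ((2 * i + 1) choose Suc i) - of_nat ((2 * i + 1) choose i)"
    unfolding n by (simp add: right_diff_distrib Suc flip: binomial_gbinomial del: of_nat_add of_nat_Suc)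
  also have "(2 * i + 1) choose Suc i = (2 * i + 1) choose i"
    by (subst binomial_symmetric) auto
  finally show ?thesis using Suc by simp
qed auto

text \<open>
  Lagrange inversion for the substitution \<open>\<psi> = c X / (1 + X)\<^sup>2\<close>, obtained term by term: multiplying \<open>\<psi>\<^sup>i\<close> by
  \<open>(1 + X)\<^sup>2\<^sup>m\<^sup>-\<^sup>1 (1 - X)\<close> gives \<open>c\<^sup>i X\<^sup>i\<close> times the series of the preceding lemma for
  \<open>m - i\<close>, so that among all powers only \<open>i = m\<close> contributes to the coefficient.
\<close>

lemma fps_nth_lagrange_binomial:
  fixes g :: "'a :: field_char_0 fps" and c :: 'a
  defines "\<psi> \<equiv> fps_const c * (fps_X * fps_binomial (- 2))"
  shows "fps_nth (fps_binomial (2 * of_nat m - 1) * (1 - fps_X) * (g oo \<psi>)) m = c ^ m * fps_nth g m"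
proof -
  let ?c = "fps_binomial (2 * of_nat m - 1) * (1 - fps_X) :: 'a fps"
  have pow: "\<psi> ^ i = fps_const (c ^ i) * (fps_X ^ i * fps_binomial (- 2 * of_nat i))" for i
    by (simp add: \<psi>_def power_mult_distrib fps_binomial_power fps_const_power mult.commute)
  have low: "fps_nth (\<psi> ^ i) j = 0" if "j < i" for i j
    using that by (simp add: pow fps_X_power_mult_nth)
  have coeff: "fps_nth (?c * \<psi> ^ i) m = (if i = m then c ^ m else 0)" if "i \<le> m" for i
  proof -
    have "2 * of_nat m - 1 + (- 2 * of_nat i) = (2 * of_nat (m - i) - 1 :: 'a)"
      using that by (simp add: of_nat_diff algebra_simps)
    then have "fps_binomial (2 * of_nat m - 1) * fps_binomial (- 2 * of_nat i)
        = (fps_binomial (2 * of_nat (m - i) - 1) :: 'a fps)"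
      by (metis fps_binomial_add_mult)
    then have "?c * \<psi> ^ i
        = fps_const (c ^ i) * (fps_X ^ i * (fps_binomial (2 * of_nat (m - i) - 1) * (1 - fps_X)))"
      unfolding pow by (simp add: algebra_simps)
    then have "fps_nth (?c * \<psi> ^ i) m
        = c ^ i * fps_nth (fps_binomial (2 * of_nat (m - i) - 1) * (1 - fps_X)) (m - i)"
      using that by (simp only: fps_mult_left_const_nth fps_X_power_mult_nth) simp
    then show ?thesis
      unfolding fps_binomial_ballot_nth using that by auto
  qed
  have "fps_nth (?c * (g oo \<psi>)) m
      = (\<Sum>j=0..m. fps_nth ?c j * (\<Sum>i=0..m-j. fps_nth g i * fps_nth (\<psi> ^ i) (m - j)))"
    by (simp add: fps_mult_nth fps_compose_nth)
  also have "\<dots> = (\<Sum>j=0..m. fps_nth ?c j * (\<Sum>i=0..m. fps_nth g i * fps_nth (\<psi> ^ i) (m - j)))"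
    by (intro sum.cong refl arg_cong2[where f = "(*)"] sum.mono_neutral_left) (auto simp: low)
  also have "\<dots> = (\<Sum>i=0..m. fps_nth g i * (\<Sum>j=0..m. fps_nth ?c j * fps_nth (\<psi> ^ i) (m - j)))"
    unfolding sum_distrib_left by (subst sum.swap) (simp add: mult_ac)
  also have "\<dots> = (\<Sum>i=0..m. fps_nth g i * fps_nth (?c * \<psi> ^ i) m)"
    by (simp add: fps_mult_nth)
  also have "\<dots> = (\<Sum>i=0..m. if i = m then c ^ m * fps_nth g m else 0)"
    by (intro sum.cong refl) (use coeff in auto)
  finally show ?thesis by simp
qed

text \<open>
  The hypothesis says that \<open>g\<close> is the series of \<open>sqrt ((1 - p) / ((1 - x) (sqrt (1 - x) - p)))\<close>.  Under
  \<open>x = 4 w / (1 + w)\<^sup>2\<close> the root \<open>Q = sqrt (1 - x)\<close> becomes \<open>(1 - w) / (1 + w)\<close>, hence \<open>g\<close> becomes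
  \<open>(1 + w) powr (3/2) * (1 + \<zeta> w) powr (-1/2) / (1 - w)\<close>, and Lagrange inversion applies.  Working with squares avoids any
  discussion of branches: constant coefficient \<open>1\<close> selects the root.
\<close>

lemma jacobi_sum_eq_fps_nth:
  fixes p :: "'a :: field_char_0"
  assumes p: "p \<noteq> 1"
    and Q: "Q ^ 2 = 1 - fps_X" "fps_nth Q 0 = 1"
    and g: "g ^ 2 * (1 - fps_X) * (Q - fps_const p) = fps_const (1 - p)" "fps_nth g 0 = 1"
  shows "(\<Sum>k=0..m. ((2 * of_nat m + 1/2) gchoose (m - k)) * ((- 1/2) gchoose k)
            * (- (1 + p) / (1 - p)) ^ k) = 4 ^ m * fps_nth g m"
proof -
  define \<zeta> where "\<zeta> = - (1 + p) / (1 - p)"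
  define \<psi> :: "'a fps" where "\<psi> = fps_const 4 * (fps_X * fps_binomial (- 2))"
  have \<psi>0: "fps_nth \<psi> 0 = 0" by (simp add: \<psi>_def)
  define E where "E = fps_binomial (- 1/2) oo (fps_const \<zeta> * fps_X)"
  have X: "(1 + fps_X) ^ 2 * \<psi> = 4 * fps_X"
  proof -
    have "(1 + fps_X) ^ 2 * fps_binomial (- 2) = (1 :: 'a fps)"
      using fps_binomial_of_nat[of 2, where 'a = 'a] fps_binomial_add_mult[of "2 :: 'a" "- 2"] by simp
    then show ?thesis
      by (simp add: \<psi>_def algebra_simps numeral_fps_const)
  qed
  have comp1: "(1 + fps_X) ^ 2 * ((1 - fps_X) oo \<psi>) = (1 - fps_X) ^ 2"
    using X by (simp add: fps_compose_sub_distrib \<psi>0 power2_eq_square algebra_simps)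
  have Qc: "(1 + fps_X) * (Q oo \<psi>) = 1 - fps_X"
  proof (rule fps_eq_if_squares_eq)
    have "(Q oo \<psi>) ^ 2 = (1 - fps_X) oo \<psi>"
      by (simp only: fps_compose_power[OF \<psi>0, of Q 2] Q)
    then show "((1 + fps_X) * (Q oo \<psi>)) ^ 2 = (1 - fps_X) ^ 2"
      using comp1 by (simp add: power_mult_distrib)
  qed (simp_all add: Q)
  have "(g ^ 2 * (1 - fps_X) * (Q - fps_const p)) oo \<psi> = fps_const (1 - p)"
    by (simp add: g)
  then have comp: "(g oo \<psi>) ^ 2 * ((1 - fps_X) oo \<psi>) * ((Q oo \<psi>) - fps_const p) = fps_const (1 - p)"
    by (simp add: fps_compose_mult_distrib[OF \<psi>0] fps_compose_sub_distrib fps_compose_power[OF \<psi>0])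
  have "(1 + fps_X) * ((Q oo \<psi>) - fps_const p) = fps_const (1 - p) * (1 + fps_const \<zeta> * fps_X)"
  proof -
    have p1: "fps_const (1 - p) = 1 - fps_const p"
      by (simp flip: fps_const_1_eq_1)
    have "fps_const (1 - p) * fps_const \<zeta> = fps_const (- (1 + p))"
      using p by (simp add: \<zeta>_def)
    then have "(1 - fps_const p) * fps_const \<zeta> = - (1 + fps_const p)"
      unfolding p1 by (simp flip: fps_const_1_eq_1)
    then show ?thesis
      unfolding p1 using Qc by algebra
  qed
  then have "fps_const (1 - p) * ((g oo \<psi>) ^ 2 * (1 - fps_X) ^ 2 * (1 + fps_const \<zeta> * fps_X))
      = fps_const (1 - p) * (1 + fps_X) ^ 3"
    using comp1 comp by algebra
  then have sq: "(g oo \<psi>) ^ 2 * (1 - fps_X) ^ 2 * (1 + fps_const \<zeta> * fps_X) = (1 + fps_X) ^ 3"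
    using p by simp
  have E2: "E ^ 2 * (1 + fps_const \<zeta> * fps_X) = 1"
  proof -
    have "fps_binomial (- 1/2) ^ 2 * (1 + fps_X) = (1 :: 'a fps)"
      by (simp add: fps_binomial_power flip: fps_binomial_1 fps_binomial_add_mult)
    then have "(fps_binomial (- 1/2) ^ 2 * (1 + fps_X)) oo (fps_const \<zeta> * fps_X) = 1"
      by simp
    then show ?thesis
      by (simp add: E_def fps_compose_mult_distrib fps_compose_add_distrib fps_compose_power)
  qed
  have H: "(1 - fps_X) * (g oo \<psi>) = fps_binomial (3/2) * E"
  proof (rule fps_eq_if_squares_eq)
    have "(fps_binomial (3/2) :: 'a fps) ^ 2 = (1 + fps_X) ^ 3"
      using fps_binomial_of_nat[of 3, where 'a = 'a] by (simp add: fps_binomial_power)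
    then show "((1 - fps_X) * (g oo \<psi>)) ^ 2 = (fps_binomial (3/2) * E) ^ 2"
      using sq E2 by (simp only: power_mult_distrib) algebra
  qed (simp_all add: g E_def)
  have En: "fps_nth E k = ((- 1/2) gchoose k) * \<zeta> ^ k" for k
    by (simp add: E_def fps_compose_linear)
  have "fps_binomial (2 * of_nat m - 1) * (1 - fps_X) * (g oo \<psi>)
      = fps_binomial (2 * of_nat m - 1) * fps_binomial (3/2) * E"
    using H by (simp add: mult.assoc)
  also have "\<dots> = E * fps_binomial (2 * of_nat m + 1/2)"
  proof -
    have "2 * of_nat m - 1 + 3/2 = (2 * of_nat m + 1/2 :: 'a)"
      by (simp add: field_simps)
    then show ?thesis
      by (metis fps_binomial_add_mult mult.commute)
  qed
  finally have "4 ^ m * fps_nth g m = fps_nth (E * fps_binomial (2 * of_nat m + 1/2)) m"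
    using fps_nth_lagrange_binomial[where m = m and c = 4 and g = g] by (simp add: \<psi>_def)
  also have "\<dots> = (\<Sum>k=0..m. ((2 * of_nat m + 1/2) gchoose (m - k)) * ((- 1/2) gchoose k) * \<zeta> ^ k)"
    unfolding fps_mult_nth by (intro sum.cong refl) (simp add: En mult_ac)
  finally show ?thesis by (simp add: \<zeta>_def)
qed

section \<open>Functions with square-root singularities\<close>

text \<open>
  Uniform control, over parameters \<open>p\<close> in \<open>K\<close>, of functions on the unit disc with square-root singularities.  The
  model is \<open>f = sqrt y\<close> with \<open>W = 1 / \<bar>sqrt y\<bar>\<close>, for which \<open>f'\<close> is of size \<open>W\<close> and \<open>f''\<close> of size
  \<open>W\<^sup>3\<close>.  Since \<open>W\<^sup>2 \<le> W\<^sup>3\<close> for \<open>W \<ge> 1\<close>, products of two first derivatives are harmless, and the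
  class is closed under the operations from which algebraic functions are built.
\<close>

definition tame ::
    "'a set \<Rightarrow> ('a \<Rightarrow> complex \<Rightarrow> real) \<Rightarrow> ('a \<Rightarrow> complex \<Rightarrow> complex) \<Rightarrow> bool" where
  "tame K W F \<longleftrightarrow> (\<exists>C F' F''. \<forall>p\<in>K. \<forall>x\<in>ball 0 1.
     (F p has_field_derivative F' p x) (at x) \<and> (F' p has_field_derivative F'' p x) (at x) \<and>
     cmod (F p x) \<le> C \<and> cmod (F' p x) \<le> C * W p x \<and> cmod (F'' p x) \<le> C * W p x ^ 3)"

lemma tameI:
  assumes "\<And>p x. p \<in> K \<Longrightarrow> x \<in> ball 0 1 \<Longrightarrow> (F p has_field_derivative F' p x) (at x)"
    and "\<And>p x. p \<in> K \<Longrightarrow> x \<in> ball 0 1 \<Longrightarrow> (F' p has_field_derivative F'' p x) (at x)"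
    and "\<And>p x. p \<in> K \<Longrightarrow> x \<in> ball 0 1 \<Longrightarrow> cmod (F p x) \<le> C"
    and "\<And>p x. p \<in> K \<Longrightarrow> x \<in> ball 0 1 \<Longrightarrow> cmod (F' p x) \<le> C' * W p x"
    and "\<And>p x. p \<in> K \<Longrightarrow> x \<in> ball 0 1 \<Longrightarrow> cmod (F'' p x) \<le> C'' * W p x ^ 3"
    and W: "\<And>p x. p \<in> K \<Longrightarrow> x \<in> ball 0 1 \<Longrightarrow> 1 \<le> W p x"
  shows "tame K W F"
  unfolding tame_def
proof (intro exI ballI conjI)
  let ?C = "max C (max C' C'')"
  fix p x assume px: "p \<in> K" "x \<in> ball (0::complex) 1"
  note W = W[OF px]
  show "(F p has_field_derivative F' p x) (at x)" "(F' p has_field_derivative F'' p x) (at x)"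
    using px assms by auto
  show "cmod (F p x) \<le> ?C" using assms(3)[OF px] by auto
  have "C' * W p x \<le> ?C * W p x" "C'' * W p x ^ 3 \<le> ?C * W p x ^ 3"
    using W by (auto intro!: mult_right_mono)
  with assms(4,5)[OF px] show "cmod (F' p x) \<le> ?C * W p x" "cmod (F'' p x) \<le> ?C * W p x ^ 3"
    by linarith+
qed

lemma tameE:
  assumes "tame K W F"
  obtains C F' F'' where
    "\<And>p x. p \<in> K \<Longrightarrow> x \<in> ball 0 1 \<Longrightarrow> (F p has_field_derivative F' p x) (at x)"
    "\<And>p x. p \<in> K \<Longrightarrow> x \<in> ball 0 1 \<Longrightarrow> (F' p has_field_derivative F'' p x) (at x)"
    "\<And>p x. p \<in> K \<Longrightarrow> x \<in> ball 0 1 \<Longrightarrow> cmod (F p x) \<le> C"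
    "\<And>p x. p \<in> K \<Longrightarrow> x \<in> ball 0 1 \<Longrightarrow> cmod (F' p x) \<le> C * W p x"
    "\<And>p x. p \<in> K \<Longrightarrow> x \<in> ball 0 1 \<Longrightarrow> cmod (F'' p x) \<le> C * W p x ^ 3"
  using assms unfolding tame_def by blast

context
  fixes K :: "'a set" and W :: "'a \<Rightarrow> complex \<Rightarrow> real"
  assumes W: "\<forall>p\<in>K. \<forall>x\<in>ball 0 1. 1 \<le> W p x"
begin

lemma weight_lower: "p \<in> K \<Longrightarrow> x \<in> ball 0 1 \<Longrightarrow> 1 \<le> W p x"
  using W by blast

lemma weight_power_mono:
  assumes "p \<in> K" "x \<in> ball 0 1"
  shows "0 < W p x" "W p x ^ 2 \<le> W p x ^ 3"
  using weight_lower[OF assms] by (auto intro: power_increasing)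

lemma tame_const:
  assumes "\<And>p. p \<in> K \<Longrightarrow> cmod (c p) \<le> C"
  shows "tame K W (\<lambda>p x. c p)"
proof (rule tameI[where F' = "\<lambda>_ _. 0" and F'' = "\<lambda>_ _. 0" and C = C and C' = 0 and C'' = 0])
qed (use assms weight_lower in auto)

lemma tame_add:
  assumes "tame K W F" "tame K W G"
  shows "tame K W (\<lambda>p x. F p x + G p x)"
proof -
  obtain C F' F'' where F:
    "\<And>p x. p \<in> K \<Longrightarrow> x \<in> ball 0 1 \<Longrightarrow> (F p has_field_derivative F' p x) (at x)"
    "\<And>p x. p \<in> K \<Longrightarrow> x \<in> ball 0 1 \<Longrightarrow> (F' p has_field_derivative F'' p x) (at x)"
    "\<And>p x. p \<in> K \<Longrightarrow> x \<in> ball 0 1 \<Longrightarrow> cmod (F p x) \<le> C"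
    "\<And>p x. p \<in> K \<Longrightarrow> x \<in> ball 0 1 \<Longrightarrow> cmod (F' p x) \<le> C * W p x"
    "\<And>p x. p \<in> K \<Longrightarrow> x \<in> ball 0 1 \<Longrightarrow> cmod (F'' p x) \<le> C * W p x ^ 3"
    by (rule tameE[OF assms(1)]) (rule that)
  obtain D G' G'' where G:
    "\<And>p x. p \<in> K \<Longrightarrow> x \<in> ball 0 1 \<Longrightarrow> (G p has_field_derivative G' p x) (at x)"
    "\<And>p x. p \<in> K \<Longrightarrow> x \<in> ball 0 1 \<Longrightarrow> (G' p has_field_derivative G'' p x) (at x)"
    "\<And>p x. p \<in> K \<Longrightarrow> x \<in> ball 0 1 \<Longrightarrow> cmod (G p x) \<le> D"
    "\<And>p x. p \<in> K \<Longrightarrow> x \<in> ball 0 1 \<Longrightarrow> cmod (G' p x) \<le> D * W p x"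
    "\<And>p x. p \<in> K \<Longrightarrow> x \<in> ball 0 1 \<Longrightarrow> cmod (G'' p x) \<le> D * W p x ^ 3"
    by (rule tameE[OF assms(2)]) (rule that)
  show ?thesis
  proof (rule tameI[where F' = "\<lambda>p x. F' p x + G' p x" and F'' = "\<lambda>p x. F'' p x + G'' p x"
        and C = "C + D" and C' = "C + D" and C'' = "C + D"])
  qed (auto simp: distrib_right intro!: derivative_intros F G norm_triangle_mono weight_lower)
qed

lemma tame_mult:
  assumes "tame K W F" "tame K W G"
  shows "tame K W (\<lambda>p x. F p x * G p x)"
proof -
  obtain C F' F'' where F:
    "\<And>p x. p \<in> K \<Longrightarrow> x \<in> ball 0 1 \<Longrightarrow> (F p has_field_derivative F' p x) (at x)"
    "\<And>p x. p \<in> K \<Longrightarrow> x \<in> ball 0 1 \<Longrightarrow> (F' p has_field_derivative F'' p x) (at x)"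
    "\<And>p x. p \<in> K \<Longrightarrow> x \<in> ball 0 1 \<Longrightarrow> cmod (F p x) \<le> C"
    "\<And>p x. p \<in> K \<Longrightarrow> x \<in> ball 0 1 \<Longrightarrow> cmod (F' p x) \<le> C * W p x"
    "\<And>p x. p \<in> K \<Longrightarrow> x \<in> ball 0 1 \<Longrightarrow> cmod (F'' p x) \<le> C * W p x ^ 3"
    by (rule tameE[OF assms(1)]) (rule that)
  obtain D G' G'' where G:
    "\<And>p x. p \<in> K \<Longrightarrow> x \<in> ball 0 1 \<Longrightarrow> (G p has_field_derivative G' p x) (at x)"
    "\<And>p x. p \<in> K \<Longrightarrow> x \<in> ball 0 1 \<Longrightarrow> (G' p has_field_derivative G'' p x) (at x)"
    "\<And>p x. p \<in> K \<Longrightarrow> x \<in> ball 0 1 \<Longrightarrow> cmod (G p x) \<le> D"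
    "\<And>p x. p \<in> K \<Longrightarrow> x \<in> ball 0 1 \<Longrightarrow> cmod (G' p x) \<le> D * W p x"
    "\<And>p x. p \<in> K \<Longrightarrow> x \<in> ball 0 1 \<Longrightarrow> cmod (G'' p x) \<le> D * W p x ^ 3"
    by (rule tameE[OF assms(2)]) (rule that)
  show ?thesis
  proof (rule tameI[where F' = "\<lambda>p x. F' p x * G p x + F p x * G' p x"
        and F'' = "\<lambda>p x. (F'' p x * G p x + F' p x * G' p x) + (F' p x * G' p x + F p x * G'' p x)"
        and C = "C * D" and C' = "2 * C * D" and C'' = "4 * C * D"])
    fix p x assume px: "p \<in> K" "x \<in> ball (0::complex) 1"
    note b = F(3-5)[OF px] G(3-5)[OF px]
    note w = weight_power_mono[OF px]
    have CD: "0 \<le> C" "0 \<le> D"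
      using b(1,4) norm_ge_zero order_trans by blast+
    show "((\<lambda>x. F p x * G p x) has_field_derivative F' p x * G p x + F p x * G' p x) (at x)"
      by (rule derivative_eq_intros F G px refl | simp)+
    show "((\<lambda>x. F' p x * G p x + F p x * G' p x) has_field_derivative
        (F'' p x * G p x + F' p x * G' p x) + (F' p x * G' p x + F p x * G'' p x)) (at x)"
      by (rule derivative_eq_intros F G px refl | simp)+
    show "cmod (F p x * G p x) \<le> C * D"
      unfolding norm_mult using b CD(1) by (intro mult_mono) auto
    have 1: "cmod (F' p x * G p x) \<le> C * W p x * D" "cmod (F p x * G' p x) \<le> C * (D * W p x)"
      unfolding norm_mult using b CD(1) CD(2) w by (auto intro!: mult_mono)
    show "cmod (F' p x * G p x + F p x * G' p x) \<le> 2 * C * D * W p x"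
      by (rule norm_triangle_le) (use 1 in \<open>simp add: algebra_simps\<close>)
    have 2: "cmod (F'' p x * G p x) \<le> C * W p x ^ 3 * D" "cmod (F p x * G'' p x) \<le> C * (D * W p x ^ 3)"
      unfolding norm_mult using b CD(1) CD(2) w by (auto intro!: mult_mono)
    have "cmod (F' p x * G' p x) \<le> (C * W p x) * (D * W p x)"
      unfolding norm_mult using b CD(1) CD(2) w by (auto intro!: mult_mono)
    also have "\<dots> = C * D * W p x ^ 2" by (simp add: power2_eq_square)
    also have "\<dots> \<le> C * D * W p x ^ 3"
      using CD(1) CD(2) w by (intro mult_left_mono) auto
    finally have 3: "cmod (F' p x * G' p x) \<le> C * D * W p x ^ 3" .
    have "cmod ((F'' p x * G p x + F' p x * G' p x) + (F' p x * G' p x + F p x * G'' p x))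
        \<le> (C * W p x ^ 3 * D + C * D * W p x ^ 3) + (C * D * W p x ^ 3 + C * (D * W p x ^ 3))"
      by (intro norm_triangle_mono 2 3)
    then show "cmod ((F'' p x * G p x + F' p x * G' p x) + (F' p x * G' p x + F p x * G'' p x))
        \<le> 4 * C * D * W p x ^ 3" by (simp add: algebra_simps)
  qed (rule weight_lower)
qed

text \<open>
  \<open>(h \<circ> F)'' = h''(F) F'\<^sup>2 + h'(F) F''\<close>, so bounds for the derivatives of \<open>h\<close> on the values of \<open>F\<close> suffice.
\<close>

lemma tame_compose:
  assumes F: "tame K W F"
    and D: "\<And>p x. p \<in> K \<Longrightarrow> x \<in> ball 0 1 \<Longrightarrow> (h has_field_derivative h' (F p x)) (at (F p x))"
      "\<And>p x. p \<in> K \<Longrightarrow> x \<in> ball 0 1 \<Longrightarrow> (h' has_field_derivative h'' (F p x)) (at (F p x))"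
    and B: "\<And>p x. p \<in> K \<Longrightarrow> x \<in> ball 0 1 \<Longrightarrow> cmod (h (F p x)) \<le> B"
      "\<And>p x. p \<in> K \<Longrightarrow> x \<in> ball 0 1 \<Longrightarrow> cmod (h' (F p x)) \<le> B'"
      "\<And>p x. p \<in> K \<Longrightarrow> x \<in> ball 0 1 \<Longrightarrow> cmod (h'' (F p x)) \<le> B''"
  shows "tame K W (\<lambda>p x. h (F p x))"
proof -
  obtain C F' F'' where F:
    "\<And>p x. p \<in> K \<Longrightarrow> x \<in> ball 0 1 \<Longrightarrow> (F p has_field_derivative F' p x) (at x)"
    "\<And>p x. p \<in> K \<Longrightarrow> x \<in> ball 0 1 \<Longrightarrow> (F' p has_field_derivative F'' p x) (at x)"
    "\<And>p x. p \<in> K \<Longrightarrow> x \<in> ball 0 1 \<Longrightarrow> cmod (F p x) \<le> C"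
    "\<And>p x. p \<in> K \<Longrightarrow> x \<in> ball 0 1 \<Longrightarrow> cmod (F' p x) \<le> C * W p x"
    "\<And>p x. p \<in> K \<Longrightarrow> x \<in> ball 0 1 \<Longrightarrow> cmod (F'' p x) \<le> C * W p x ^ 3"
    by (rule tameE[OF assms(1)]) (rule that)
  show ?thesis
  proof (rule tameI[where F' = "\<lambda>p x. h' (F p x) * F' p x"
        and F'' = "\<lambda>p x. (h'' (F p x) * F' p x) * F' p x + h' (F p x) * F'' p x"
        and C = B and C' = "B' * C" and C'' = "B'' * C\<^sup>2 + B' * C"])
    fix p x assume px: "p \<in> K" "x \<in> ball (0::complex) 1"
    note w = weight_power_mono[OF px]
    have nonneg: "0 \<le> B'" "0 \<le> B''" "0 \<le> C"
      using B(2,3)[OF px] F(3)[OF px] norm_ge_zero order_trans by blast+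
    show der: "((\<lambda>x. h (F p x)) has_field_derivative h' (F p x) * F' p x) (at x)"
      using DERIV_chain2[OF D(1)[OF px] F(1)[OF px]] .
    have "((\<lambda>x. h' (F p x)) has_field_derivative h'' (F p x) * F' p x) (at x)"
      using DERIV_chain2[OF D(2)[OF px] F(1)[OF px]] .
    from DERIV_mult[OF this F(2)[OF px]]
    show "((\<lambda>x. h' (F p x) * F' p x) has_field_derivative
        (h'' (F p x) * F' p x) * F' p x + h' (F p x) * F'' p x) (at x)"
      by (simp add: add_ac mult_ac)
    show "cmod (h' (F p x) * F' p x) \<le> B' * C * W p x"
      unfolding norm_mult mult.assoc using B(2)[OF px] F(4)[OF px] nonneg by (intro mult_mono) auto
    have "cmod (h'' (F p x) * F' p x * F' p x) \<le> B'' * (C * W p x) * (C * W p x)"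
      unfolding norm_mult using B(3)[OF px] F(4)[OF px] nonneg w by (intro mult_mono) auto
    also have "\<dots> = B'' * C\<^sup>2 * W p x ^ 2" by (simp add: power2_eq_square)
    also have "\<dots> \<le> B'' * C\<^sup>2 * W p x ^ 3"
      using nonneg w by (intro mult_left_mono) auto
    finally have "cmod (h'' (F p x) * F' p x * F' p x) \<le> B'' * C\<^sup>2 * W p x ^ 3" .
    moreover have "cmod (h' (F p x) * F'' p x) \<le> B' * (C * W p x ^ 3)"
      unfolding norm_mult using B(2)[OF px] F(5)[OF px] nonneg by (intro mult_mono) auto
    ultimately show "cmod (h'' (F p x) * F' p x * F' p x + h' (F p x) * F'' p x)
        \<le> (B'' * C\<^sup>2 + B' * C) * W p x ^ 3"
      by (intro norm_triangle_le) (simp add: algebra_simps)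
  qed (use B weight_lower in auto)
qed

lemma tame_inverse:
  assumes F: "tame K W F" and c: "c > 0"
    and low: "\<And>p x. p \<in> K \<Longrightarrow> x \<in> ball 0 1 \<Longrightarrow> c \<le> cmod (F p x)"
  shows "tame K W (\<lambda>p x. inverse (F p x))"
proof (rule tame_compose[OF F, where h' = "\<lambda>y. - (inverse y ^ 2)" and h'' = "\<lambda>y. 2 * inverse y ^ 3"
      and B = "inverse c" and B' = "inverse c ^ 2" and B'' = "2 * inverse c ^ 3"])
  fix p x assume px: "p \<in> K" "x \<in> ball (0::complex) 1"
  have nz: "F p x \<noteq> 0" using low[OF px] c by auto
  have inv: "cmod (inverse (F p x)) \<le> inverse c"
    using low[OF px] c by (simp add: norm_inverse le_imp_inverse_le)
  show "(inverse has_field_derivative - (inverse (F p x) ^ 2)) (at (F p x))"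
    using DERIV_inverse[OF nz] by (simp add: power2_eq_square)
  show "((\<lambda>y. - (inverse y ^ 2)) has_field_derivative 2 * inverse (F p x) ^ 3) (at (F p x))"
    by (rule derivative_eq_intros refl nz)+ (simp add: power2_eq_square power3_eq_cube)
  show "cmod (inverse (F p x)) \<le> inverse c" by (rule inv)
  show "cmod (- (inverse (F p x) ^ 2)) \<le> inverse c ^ 2" "cmod (2 * inverse (F p x) ^ 3) \<le> 2 * inverse c ^ 3"
    using power_mono[OF inv, of 2] power_mono[OF inv, of 3] by (simp_all only: norm_minus_cancel norm_mult norm_power norm_ge_zero) simp_all
qed

lemma tame_csqrt:
  assumes F: "tame K W F" and c: "c > 0"
    and low: "\<And>p x. p \<in> K \<Longrightarrow> x \<in> ball 0 1 \<Longrightarrow> c \<le> cmod (F p x)"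
    and slit: "\<And>p x. p \<in> K \<Longrightarrow> x \<in> ball 0 1 \<Longrightarrow> F p x \<notin> \<real>\<^sub>\<le>\<^sub>0"
  shows "tame K W (\<lambda>p x. csqrt (F p x))"
proof -
  obtain C where C: "\<And>p x. p \<in> K \<Longrightarrow> x \<in> ball 0 1 \<Longrightarrow> cmod (F p x) \<le> C"
    by (rule tameE[OF F]) (rule that)
  define d where "d = inverse (sqrt c)"
  show ?thesis
  proof (rule tame_compose[OF F, where h' = "\<lambda>y. inverse (csqrt y) / 2"
        and h'' = "\<lambda>y. - (inverse (csqrt y) ^ 3) / 4"
        and B = "sqrt C" and B' = "d / 2" and B'' = "d ^ 3 / 4"])
    fix p x assume px: "p \<in> K" "x \<in> ball (0::complex) 1"
    have inv: "cmod (inverse (csqrt (F p x))) \<le> d"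
      using low[OF px] c by (simp add: d_def norm_inverse le_imp_inverse_le)
    have nz: "csqrt (F p x) \<noteq> 0" using low[OF px] c by auto
    show D: "(csqrt has_field_derivative inverse (csqrt (F p x)) / 2) (at (F p x))"
      using has_field_derivative_csqrt[OF slit[OF px]] by (simp add: field_simps)
    show "((\<lambda>y. inverse (csqrt y) / 2) has_field_derivative - (inverse (csqrt (F p x)) ^ 3) / 4) (at (F p x))"
      using DERIV_cdivide[OF DERIV_inverse'[OF D nz], of 2] by (simp add: power3_eq_cube mult_ac)
    show "cmod (csqrt (F p x)) \<le> sqrt C" using C[OF px] by simp
    show "cmod (inverse (csqrt (F p x)) / 2) \<le> d / 2" using inv by (simp add: norm_divide)
    show "cmod (- (inverse (csqrt (F p x)) ^ 3) / 4) \<le> d ^ 3 / 4"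
      using power_mono[OF inv, of 3] by (simp add: norm_divide norm_power)
  qed
qed

end

section \<open>Coefficients from a bound for the second derivative\<close>

lemma DERIV_inverse_sqrt:
  "0 < v \<Longrightarrow> ((\<lambda>v. 2 * inverse (sqrt v)) has_real_derivative - (inverse (sqrt v) ^ 3)) (at v)"
  by (auto intro!: derivative_eq_intros simp: power3_eq_cube field_simps)

text \<open>
  The bound does not depend on the position \<open>a\<close> of the peak, which takes the place of a rotation of the circle below.
\<close>

lemma integral_shifted_kernel_le:
  fixes a d :: real
  assumes d: "0 < d"
  shows "(\<lambda>t. inverse (sqrt (d + \<bar>t - a\<bar>)) ^ 3) integrable_on {0..1}"
    and "integral {0..1} (\<lambda>t. inverse (sqrt (d + \<bar>t - a\<bar>)) ^ 3) \<le> 4 / sqrt d"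
proof -
  \<comment> \<open>An antiderivative away from \<open>t = a\<close>; the maxima make it continuous there.\<close>
  define F where "F t = 2 * inverse (sqrt (d + max (a - t) 0)) - 2 * inverse (sqrt (d + max (t - a) 0))" for t
  have "((\<lambda>t. inverse (sqrt (d + \<bar>t - a\<bar>)) ^ 3) has_integral F 1 - F 0) {0..1}"
  proof (rule fundamental_theorem_of_calculus_interior_strong[of "{a}"])
    show "continuous_on {0..1} F"
      unfolding F_def using d by (intro continuous_intros ballI) (auto simp: add_pos_nonneg dest: add_pos_nonneg)
    fix t assume t: "t \<in> {0<..<1} - {a}"
    show "(F has_vector_derivative inverse (sqrt (d + \<bar>t - a\<bar>)) ^ 3) (at t)"
    proof (cases "t < a")
      case True
      have "((\<lambda>t. 2 * inverse (sqrt (d + (a - t))) - 2 * inverse (sqrt d))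
          has_real_derivative inverse (sqrt (d + \<bar>t - a\<bar>)) ^ 3) (at t)"
        using d True
        by (auto simp: power3_eq_cube
            intro!: derivative_eq_intros DERIV_chain2[OF DERIV_inverse_sqrt, of "\<lambda>t. d + (a - t)"])
      moreover have "eventually (\<lambda>t. t < a) (nhds t)"
        using True eventually_nhds_in_open[of "{..<a}" t] by simp
      then have "eventually (\<lambda>t. 2 * inverse (sqrt (d + (a - t))) - 2 * inverse (sqrt d) = F t) (nhds t)"
        by eventually_elim (simp add: F_def)
      ultimately show ?thesis
        by (simp add: has_real_derivative_iff_has_vector_derivative[symmetric] DERIV_cong_ev)
    next
      case False
      with t have True: "a < t" by auto
      have "((\<lambda>t. 2 * inverse (sqrt d) - 2 * inverse (sqrt (d + (t - a))))
          has_real_derivative inverse (sqrt (d + \<bar>t - a\<bar>)) ^ 3) (at t)"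
        using d True
        by (auto simp: power3_eq_cube
            intro!: derivative_eq_intros DERIV_chain2[OF DERIV_inverse_sqrt, of "\<lambda>t. d + (t - a)"])
      moreover have "eventually (\<lambda>t. a < t) (nhds t)"
        using True eventually_nhds_in_open[of "{a<..}" t] by simp
      then have "eventually (\<lambda>t. 2 * inverse (sqrt d) - 2 * inverse (sqrt (d + (t - a))) = F t) (nhds t)"
        by eventually_elim (simp add: F_def)
      ultimately show ?thesis
        by (simp add: has_real_derivative_iff_has_vector_derivative[symmetric] DERIV_cong_ev)
    qed
  qed auto
  moreover have "F 1 - F 0 \<le> 4 / sqrt d"
  proof -
    have "inverse (sqrt (d + max u 0)) \<le> inverse (sqrt d)" "0 \<le> inverse (sqrt (d + max u 0))" for u
      using d by (auto intro!: le_imp_inverse_le)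
    from this[of "a - 1"] this[of "1 - a"] this[of "a - 0"] this[of "0 - a"]
    show ?thesis unfolding F_def divide_inverse by linarith
  qed
  ultimately show "(\<lambda>t. inverse (sqrt (d + \<bar>t - a\<bar>)) ^ 3) integrable_on {0..1}"
    "integral {0..1} (\<lambda>t. inverse (sqrt (d + \<bar>t - a\<bar>)) ^ 3) \<le> 4 / sqrt d"
    by (auto simp: has_integral_integrable_integral)
qed

lemma abs_le_abs_sin_pi:
  fixes u :: real
  assumes "\<bar>u\<bar> \<le> 1/2"
  shows "\<bar>u\<bar> \<le> \<bar>sin (pi * u)\<bar>"
proof -
  define y where "y = pi * \<bar>u\<bar>"
  have "pi * \<bar>u\<bar> \<le> pi * (1/2)" using assms by (intro mult_left_mono) auto
  also have "\<dots> \<le> 1.6" using pi_approx by simp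
  finally have y: "0 \<le> y" "y \<le> 1.6"
    by (auto simp: y_def)
  have "\<bar>sin y - y\<bar> \<le> inverse 6 * \<bar>y\<bar> ^ 3"
    using Maclaurin_sin_bound[of y 3] by (simp add: numeral_eq_Suc sin_coeff_def fact_reduce)
  then have "y - y ^ 3 / 6 \<le> sin y" using y by (simp add: abs_if split: if_splits)
  moreover have "y ^ 3 \<le> 3 * y"
  proof -
    have "y * y \<le> 1.6 * 1.6" using y by (intro mult_mono) auto
    then have "y * y * y \<le> 3 * y" using y by (intro mult_right_mono) auto
    then show ?thesis by (simp add: power3_eq_cube)
  qed
  ultimately have "y / 2 \<le> sin y" by simp
  moreover have "\<bar>u\<bar> \<le> y / 2"
    using pi_gt3 mult_right_mono[of 2 pi "\<bar>u\<bar>"] by (simp add: y_def)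
  moreover have "sin y = sin (pi * u) \<or> sin y = - sin (pi * u)"
    by (auto simp: y_def abs_if)
  ultimately show ?thesis by auto
qed

text \<open>
  Moving the point radially to the unit circle changes its distance to \<open>1\<close> by at most \<open>1 - \<rho>\<close>, itself at most that
  distance, and on the unit circle the distance is a chord, \<open>2 \<bar>sin (pi u)\<bar>\<close>.
\<close>

lemma norm_one_minus_polar_ge:
  fixes \<rho> d u :: real
  assumes "0 \<le> \<rho>" "\<rho> \<le> 1 - d" "\<bar>u\<bar> \<le> 1/2" "0 \<le> d"
  shows "d + \<bar>u\<bar> \<le> 2 * cmod (1 - of_real \<rho> * cis (2 * pi * u))"
proof -
  let ?y = "cmod (1 - of_real \<rho> * cis (2 * pi * u))"
  have 1: "1 - \<rho> \<le> ?y"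
    using norm_triangle_ineq2[of 1 "of_real \<rho> * cis (2 * pi * u)"] assms by (simp add: norm_mult)
  have "cmod (1 - cis (2 * pi * u)) \<le> ?y + cmod (of_real (\<rho> - 1) * cis (2 * pi * u))"
    by (rule order_trans[OF _ norm_triangle_ineq]) (simp add: algebra_simps)
  also have "\<dots> \<le> 2 * ?y"
    unfolding norm_mult norm_of_real using 1 assms by simp
  finally have 2: "cmod (1 - cis (2 * pi * u)) \<le> 2 * ?y" .
  have "cmod (1 - cis (2 * pi * u)) = 2 * \<bar>sin (pi * u)\<bar>"
  proof -
    have "cmod (1 - cis (2 * pi * u)) ^ 2 = (1 - cos (2 * (pi * u))) ^ 2 + sin (2 * (pi * u)) ^ 2"
      by (simp add: cmod_power2 mult.assoc)
    also have "\<dots> = 4 * sin (pi * u) ^ 2 * (sin (pi * u) ^ 2 + cos (pi * u) ^ 2)"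
      unfolding cos_double_sin sin_double by algebra
    also have "\<dots> = (2 * \<bar>sin (pi * u)\<bar>) ^ 2"
      by (simp add: power_mult_distrib)
    finally show ?thesis by (rule power2_eq_imp_eq) auto
  qed
  with 2 abs_le_abs_sin_pi[OF assms(3)] 1 assms show ?thesis by linarith
qed

text \<open>
  For \<open>\<bar>s\<bar> \<le> 1\<close> one of \<open>s\<close>, \<open>s - 1\<close>, \<open>s + 1\<close> is at most \<open>1/2\<close> in absolute value; the sum of the three kernels
  covers all cases at once.
\<close>

lemma singular_kernel_le_shifted_kernels:
  fixes \<rho> d s :: real
  assumes "0 \<le> \<rho>" "\<rho> \<le> 1 - d" "0 < d" "\<bar>s\<bar> \<le> 1"
  shows "inverse (sqrt (cmod (1 - of_real \<rho> * cis (2 * pi * s)))) ^ 3 \<le>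
    3 * (inverse (sqrt (d + \<bar>s\<bar>)) ^ 3 + inverse (sqrt (d + \<bar>s - 1\<bar>)) ^ 3 + inverse (sqrt (d + \<bar>s + 1\<bar>)) ^ 3)"
proof -
  have key: "inverse (sqrt (cmod (1 - of_real \<rho> * cis (2 * pi * u)))) ^ 3 \<le> 3 * inverse (sqrt (d + \<bar>u\<bar>)) ^ 3"
    if "\<bar>u\<bar> \<le> 1/2" for u
  proof -
    let ?y = "cmod (1 - of_real \<rho> * cis (2 * pi * u))"
    have y: "d + \<bar>u\<bar> \<le> 2 * ?y"
      using norm_one_minus_polar_ge[OF assms(1,2) that] assms by simp
    have "sqrt (d + \<bar>u\<bar>) \<le> sqrt 2 * sqrt ?y"
      using real_sqrt_le_mono[OF y] by (simp add: real_sqrt_mult)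
    moreover have "0 < sqrt (d + \<bar>u\<bar>)" using assms by simp
    moreover have "0 < d + \<bar>u\<bar>" using assms by simp
    then have "0 < sqrt ?y" using y by (intro real_sqrt_gt_zero) linarith
    ultimately have "inverse (sqrt ?y) \<le> sqrt 2 * inverse (sqrt (d + \<bar>u\<bar>))"
      by (simp add: field_simps)
    then have "inverse (sqrt ?y) ^ 3 \<le> (sqrt 2 * inverse (sqrt (d + \<bar>u\<bar>))) ^ 3"
      by (intro power_mono) auto
    also have "\<dots> = (2 * sqrt 2) * inverse (sqrt (d + \<bar>u\<bar>)) ^ 3"
      by (simp only: power_mult_distrib) (simp add: power3_eq_cube)
    also have "\<dots> \<le> 3 * inverse (sqrt (d + \<bar>u\<bar>)) ^ 3"
    proof (intro mult_right_mono)
      have "sqrt 2 \<le> 1.5" by (rule real_le_lsqrt) (auto simp: power2_eq_square)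
      then show "2 * sqrt 2 \<le> 3" by simp
    qed (use assms in auto)
    finally show ?thesis .
  qed
  define \<kappa> where "\<kappa> u = inverse (sqrt (d + \<bar>u\<bar>)) ^ 3" for u
  have nn: "0 \<le> \<kappa> u" for u using assms by (simp add: \<kappa>_def)
  have add: "x \<le> 3 * a \<Longrightarrow> 0 \<le> b \<Longrightarrow> 0 \<le> c \<Longrightarrow> x \<le> 3 * (a + b + c)"
    "x \<le> 3 * b \<Longrightarrow> 0 \<le> a \<Longrightarrow> 0 \<le> c \<Longrightarrow> x \<le> 3 * (a + b + c)"
    "x \<le> 3 * c \<Longrightarrow> 0 \<le> a \<Longrightarrow> 0 \<le> b \<Longrightarrow> x \<le> 3 * (a + b + c)" for x a b c :: real
    by auto
  note key = key[folded \<kappa>_def]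
  have per: "cis (2 * pi * (s - 1)) = cis (2 * pi * s)" "cis (2 * pi * (s + 1)) = cis (2 * pi * s)"
    by (simp_all add: right_diff_distrib distrib_left cis_divide[symmetric] cis_mult[symmetric])
  consider "\<bar>s\<bar> \<le> 1/2" | "\<bar>s - 1\<bar> \<le> 1/2" | "\<bar>s + 1\<bar> \<le> 1/2"
    using assms(4) by linarith
  then show ?thesis
  proof cases
    case 1 show ?thesis
      unfolding \<kappa>_def[symmetric]
      using key[OF 1] by (intro add(1) nn)
  next
    case 2 show ?thesis
      unfolding \<kappa>_def[symmetric]
      using key[OF 2] by (intro add(2) nn) (simp only: per)
  next
    case 3 show ?thesis
      unfolding \<kappa>_def[symmetric]
      using key[OF 3] by (intro add(3) nn) (simp only: per)
  qed
qed

lemma inverse_power_circle_radius_le: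
  assumes "2 \<le> m"
  shows "inverse (1 - 1 / real m) ^ (m - 2) \<le> 3"
proof -
  have e: "inverse (1 - 1 / real m) = 1 + 1 / real (m - 1)"
    using assms by (simp add: of_nat_diff field_simps)
  have "inverse (1 - 1 / real m) ^ (m - 2) \<le> (1 + 1 / real (m - 1)) ^ (m - 1)"
    unfolding e by (rule power_increasing) auto
  also have "\<dots> \<le> exp 1"
    using exp_ge_one_plus_x_over_n_power_n[of "m - 1" 1] assms by simp
  also have "\<dots> \<le> 3" by (rule exp_le)
  finally show ?thesis .
qed

lemma sum_cubed_le:
  fixes a b :: real
  assumes "0 \<le> a" "0 \<le> b"
  shows "(a + b) ^ 3 \<le> 4 * (a ^ 3 + b ^ 3)"
proof -
  \<comment> \<open>The difference of the two sides factors.\<close>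
  have "0 \<le> 3 * ((a + b) * (a - b) ^ 2)" using assms by simp
  also have "\<dots> = 4 * (a ^ 3 + b ^ 3) - (a + b) ^ 3"
    by (simp add: power2_eq_square power3_eq_cube algebra_simps)
  finally show ?thesis by simp
qed

lemma circle_integral_kernel_le:
  fixes \<rho> d \<beta> :: real
  assumes "0 \<le> \<rho>" "\<rho> \<le> 1 - d" "0 < d" "0 \<le> \<beta>" "\<beta> \<le> 1"
  obtains h where "h integrable_on {0..1}" "integral {0..1} h \<le> 36 / sqrt d"
    "\<And>t. t \<in> {0..1} \<Longrightarrow> inverse (sqrt (cmod (1 - of_real \<rho> * cis (2 * pi * (t - \<beta>))))) ^ 3 \<le> h t"
proof
  define k where "k a t = inverse (sqrt (d + \<bar>t - a\<bar>)) ^ 3" for a t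
  have k: "k a integrable_on {0..1}" "integral {0..1} (k a) \<le> 4 / sqrt d" for a
    using integral_shifted_kernel_le[OF assms(3), of a] unfolding k_def by auto
  define h where "h t = 3 * (k \<beta> t + k (\<beta> + 1) t + k (\<beta> - 1) t)" for t
  show "h integrable_on {0..1}" unfolding h_def by (intro integrable_on_mult_right integrable_add k)
  have "integral {0..1} h = 3 * (integral {0..1} (k \<beta>) + integral {0..1} (k (\<beta> + 1)) + integral {0..1} (k (\<beta> - 1)))"
    unfolding h_def by (simp add: integral_add integrable_add k)
  also have "\<dots> \<le> 36 / sqrt d"
    using k(2)[of \<beta>] k(2)[of "\<beta> + 1"] k(2)[of "\<beta> - 1"] by simp
  finally show "integral {0..1} h \<le> 36 / sqrt d" .
  fix t :: real assume "t \<in> {0..1}"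
  with assms have "\<bar>t - \<beta>\<bar> \<le> 1" by auto
  from singular_kernel_le_shifted_kernels[OF assms(1-3) this]
  show "inverse (sqrt (cmod (1 - of_real \<rho> * cis (2 * pi * (t - \<beta>))))) ^ 3 \<le> h t"
    by (simp add: h_def k_def algebra_simps)
qed

text \<open>
  Two derivatives gain the factor \<open>m (m - 1)\<close> on the \<open>m\<close>-th coefficient.  On the circle of radius \<open>r = 1 - 1/m\<close> the mean of
  \<open>\<bar>1 - x\<bar> powr (-3/2)\<close> is at most a multiple of \<open>sqrt m\<close>, while \<open>r\<^sup>-\<^sup>m\<close> stays bounded; together this gives
  \<open>m powr (-3/2)\<close>.  The singularity at \<open>b\<close> is treated by writing \<open>x / b\<close> in polar form: its modulus is at most \<open>r\<close>, and its
  argument is shifted by that of \<open>b\<close>.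
\<close>

lemma coefficient_bound_by_second_derivative:
  fixes F :: "complex \<Rightarrow> complex"
  assumes F: "\<And>x. x \<in> ball 0 1 \<Longrightarrow> (F has_field_derivative F' x) (at x)"
    and F': "\<And>x. x \<in> ball 0 1 \<Longrightarrow> (F' has_field_derivative F'' x) (at x)"
    and C: "0 \<le> C"
    and b: "1 \<le> cmod b"
    and bound: "\<And>x. x \<in> ball 0 1 \<Longrightarrow>
      cmod (F'' x) \<le> C * (inverse (sqrt (cmod (1 - x))) + inverse (sqrt (cmod (1 - x / b)))) ^ 3"
    and m: "2 \<le> m"
  shows "cmod ((deriv ^^ m) F 0 / fact m) \<le> 1728 * C / (real m * sqrt (real m))"
proof -
  define d where "d = 1 / real m"
  define r where "r = 1 - d"
  have d: "0 < d" "0 < r" "r < 1" "r \<le> 1 - d" using m by (auto simp: d_def r_def)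
  have b0: "b \<noteq> 0" using b by auto
  define k where "k = m - 2"
  have mk: "m = Suc (Suc k)" using m by (simp add: k_def)
  have derF: "deriv F x = F' x" "deriv F' x = F'' x" if "x \<in> ball 0 1" for x
    using F[OF that] F'[OF that] by (auto intro: DERIV_imp_deriv)
  have holF': "F' holomorphic_on ball 0 1"
    using F' unfolding holomorphic_on_open[OF open_ball] by blast
  have "deriv F' holomorphic_on ball 0 1"
    by (intro holomorphic_deriv holF' open_ball)
  then have holF'': "F'' holomorphic_on ball 0 1"
    by (rule holomorphic_transform) (use derF in auto)
  \<comment> \<open>The \<open>m\<close>-th derivative of \<open>F\<close> is the \<open>k\<close>-th derivative of \<open>F''\<close>.\<close>
  have ev: "eventually (\<lambda>x. x \<in> ball 0 1) (nhds (0::complex))"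
    by (rule eventually_nhds_in_open) auto
  have "(deriv ^^ m) F 0 = (deriv ^^ Suc k) (deriv F) 0"
    unfolding mk by (simp only: funpow_Suc_right o_def)
  also have "\<dots> = (deriv ^^ Suc k) F' 0"
    using ev by (intro higher_deriv_cong_ev) (auto elim!: eventually_mono simp: derF)
  also have "\<dots> = (deriv ^^ k) (deriv F') 0"
    by (simp only: funpow_Suc_right o_def)
  also have "\<dots> = (deriv ^^ k) F'' 0"
    using ev by (intro higher_deriv_cong_ev) (auto elim!: eventually_mono simp: derF)
  finally have D: "(deriv ^^ m) F 0 = (deriv ^^ k) F'' 0" .

  define x where "x t = of_real r * cis (2 * pi * t)" for t
  have xcirc: "circlepath 0 r t = x t" for t
    by (simp add: circlepath_def x_def part_circlepath_def linepath_def cis_conv_exp algebra_simps)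
  have normx: "cmod (x t) = r" for t using d by (simp add: x_def norm_mult)
  have xball: "x t \<in> ball 0 1" for t using d normx by simp

  let ?S = "2 * pi * \<i> / fact k * (deriv ^^ k) F'' 0"
  have "((\<lambda>u. F'' u / (u - 0) ^ Suc k) has_contour_integral ?S) (circlepath 0 r)"
  proof (rule Cauchy_has_contour_integral_higher_derivative_circlepath)
    show "continuous_on (cball 0 r) F''" "F'' holomorphic_on ball 0 r"
      using holF'' d
      by (auto intro!: holomorphic_on_imp_continuous_on intro: holomorphic_on_subset simp: subset_iff)
  qed (use d in auto)
  then have I: "((\<lambda>t. F'' (x t) / x t ^ Suc k * vector_derivative (circlepath 0 r) (at t within {0..1})) has_integral ?S) {0..1}"
    by (simp add: has_contour_integral_def xcirc)
  define \<beta> where "\<beta> = Arg2pi b / (2 * pi)"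
  have \<beta>: "0 \<le> \<beta>" "\<beta> \<le> 1" using Arg2pi[of b] by (auto simp: \<beta>_def)
  have bpolar: "b = of_real (cmod b) * cis (2 * pi * \<beta>)"
    using Arg2pi_eq[of b] by (simp add: \<beta>_def cis_conv_exp)
  have xb: "x t / b = of_real (r / cmod b) * cis (2 * pi * (t - \<beta>))" for t
    by (subst bpolar) (simp add: x_def right_diff_distrib cis_divide[symmetric])
  obtain h1 where h1: "h1 integrable_on {0..1}" "integral {0..1} h1 \<le> 36 / sqrt d"
    "\<And>t. t \<in> {0..1} \<Longrightarrow> inverse (sqrt (cmod (1 - of_real r * cis (2 * pi * (t - 0))))) ^ 3 \<le> h1 t"
    using circle_integral_kernel_le[of r d 0] d by auto
  have "r * 1 \<le> r * cmod b" using d b by (intro mult_left_mono) auto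
  then have rb: "0 \<le> r / cmod b" "r / cmod b \<le> 1 - d"
    using d b0 by (auto simp: pos_divide_le_eq r_def)
  obtain h2 where h2: "h2 integrable_on {0..1}" "integral {0..1} h2 \<le> 36 / sqrt d"
    "\<And>t. t \<in> {0..1} \<Longrightarrow> inverse (sqrt (cmod (1 - of_real (r / cmod b) * cis (2 * pi * (t - \<beta>))))) ^ 3 \<le> h2 t"
    using circle_integral_kernel_le[OF rb d(1) \<beta>] by auto
  define c where "c = 2 * pi * inverse r ^ k * (4 * C)"
  have c0: "0 \<le> c" using d C by (simp add: c_def)
  have pw: "cmod (F'' (x t) / x t ^ Suc k * vector_derivative (circlepath 0 r) (at t within {0..1}))
      \<le> c * (h1 t + h2 t)" if t: "t \<in> {0..1}" for t
  proof -
    have "cmod (F'' (x t) / x t ^ Suc k * vector_derivative (circlepath 0 r) (at t within {0..1}))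
        = 2 * pi * inverse r ^ k * cmod (F'' (x t))"
      using t d by (simp add: vector_derivative_circlepath01 norm_mult norm_divide norm_power normx field_simps)
    also have "\<dots> \<le> 2 * pi * inverse r ^ k * (C * (4 * (inverse (sqrt (cmod (1 - x t))) ^ 3 + inverse (sqrt (cmod (1 - x t / b))) ^ 3)))"
      using d C by (intro mult_left_mono order_trans[OF bound[OF xball]] sum_cubed_le) auto
    also have "\<dots> = c * (inverse (sqrt (cmod (1 - x t))) ^ 3 + inverse (sqrt (cmod (1 - x t / b))) ^ 3)"
      by (simp add: c_def)
    also have "\<dots> \<le> c * (h1 t + h2 t)"
      using h1(3)[OF t] h2(3)[OF t] c0 by (intro mult_left_mono add_mono) (simp_all add: xb, simp_all add: x_def)
    finally show ?thesis .
  qed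
  have "cmod ?S \<le> integral {0..1} (\<lambda>t. c * (h1 t + h2 t))"
    unfolding integral_unique[OF I, symmetric]
    by (rule integral_norm_bound_integral[OF has_integral_integrable[OF I] _ pw])
      (intro integrable_on_mult_right integrable_add h1 h2)
  also have "\<dots> = c * (integral {0..1} h1 + integral {0..1} h2)"
    by (simp add: integral_add h1 h2)
  also have "\<dots> \<le> c * (72 / sqrt d)"
    using h1(2) h2(2) c0 by (intro mult_left_mono) auto
  also have "\<dots> = 2 * pi * (inverse r ^ k * (288 * C * sqrt (real m)))"
    by (simp add: c_def d_def real_sqrt_divide)
  also have "\<dots> \<le> 2 * pi * (3 * (288 * C * sqrt (real m)))"
    using inverse_power_circle_radius_le[OF m] C
    by (intro mult_left_mono mult_right_mono) (auto simp: k_def r_def d_def)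
  finally have "(2 * pi) * (cmod ((deriv ^^ k) F'' 0) / fact k) \<le> (2 * pi) * (864 * C * sqrt (real m))"
    by (simp add: norm_mult norm_divide)
  then have "cmod ((deriv ^^ k) F'' 0) / fact k \<le> 864 * C * sqrt (real m)"
    by (subst (asm) mult_le_cancel_left_pos) auto
  then have le: "cmod ((deriv ^^ k) F'' 0) / fact k / (real m * real (m - 1))
      \<le> 864 * C * sqrt (real m) / (real m * real (m - 1))"
    by (rule divide_right_mono) simp
  have fm: "(fact m :: real) = fact k * (real m * real (m - 1))"
    by (simp add: mk)
  have "cmod ((deriv ^^ m) F 0 / fact m) = cmod ((deriv ^^ k) F'' 0) / fact m"
    by (simp add: D norm_divide)
  also have "\<dots> = cmod ((deriv ^^ k) F'' 0) / fact k / (real m * real (m - 1))"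
    unfolding fm by (rule divide_divide_eq_left[symmetric])
  also note le
  also have "864 * C * sqrt (real m) / (real m * real (m - 1)) \<le> 864 * C * sqrt (real m) / (real m * (real m / 2))"
  proof (rule divide_left_mono)
    have "real m / 2 \<le> real (m - 1)" using m by (simp add: of_nat_diff)
    then show "real m * (real m / 2) \<le> real m * real (m - 1)" by (rule mult_left_mono) simp
  qed (use m C in simp_all)
  also have "\<dots> = 1728 * C / (real m * sqrt (real m))"
  proof -
    have "864 * C * s / (s * s * (s * s / 2)) = 1728 * C / (s * s * s)" if "s > 0" for s :: real
      using that by (simp add: field_simps)
    from this[of "sqrt (real m)"] m show ?thesis by simp
  qed
  finally show ?thesis .
qed

section \<open>The remainder of the generating function\<close>

text \<open>
  The root that vanishes at \<open>b\<close>, normalised to \<open>1\<close> at \<open>0\<close>; for \<open>b = 1\<close> it is \<open>sqrt (1 - x)\<close>.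
\<close>

definition branch_sqrt :: "complex \<Rightarrow> complex \<Rightarrow> complex" where
  "branch_sqrt b x = csqrt (1 - x / b)"

definition weight :: "complex \<Rightarrow> complex \<Rightarrow> real" where
  "weight b x = inverse (sqrt (cmod (1 - x))) + inverse (sqrt (cmod (1 - x / b)))"

lemma one_minus_div_bounds:
  assumes "1 \<le> cmod b" "x \<in> ball 0 1"
  shows "0 < Re (1 - x / b)" "cmod (1 - x / b) \<le> 2"
proof -
  have "cmod (x / b) < 1"
    using assms by (auto simp: norm_divide divide_less_eq)
  then show "0 < Re (1 - x / b)" "cmod (1 - x / b) \<le> 2"
    using complex_Re_le_cmod[of "x / b"] norm_triangle_ineq4[of 1 "x / b"] by auto
qed

lemma weight_ge_1:
  assumes "1 \<le> cmod b" "x \<in> ball 0 1"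
  shows "1 \<le> weight b x"
proof -
  have half: "1 / 2 \<le> inverse (sqrt (cmod (1 - x / c)))" if "1 \<le> cmod c" for c
  proof -
    have "0 < Re (1 - x / c)" "cmod (1 - x / c) \<le> 2"
      using one_minus_div_bounds[OF that assms(2)] .
    then have "0 < cmod (1 - x / c)" "sqrt (cmod (1 - x / c)) \<le> 2"
      by (auto intro!: real_le_lsqrt)
    then show ?thesis by (simp add: field_simps)
  qed
  show ?thesis using half[of 1] half[OF assms(1)] by (simp add: weight_def)
qed

lemma Re_csqrt_pos:
  assumes "0 < Re z"
  shows "0 < Re (csqrt z)"
proof -
  have "0 < Re ((csqrt z)\<^sup>2)" using assms by simp
  then have "Re (csqrt z) \<noteq> 0"
    unfolding Re_power2 using zero_le_power2[of "Im (csqrt z)"] by auto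
  then show ?thesis using csqrt_principal[of z] by auto
qed

text \<open>
  A square root of a point of the right half-plane lies in the sector \<open>\<bar>Arg\<bar> < pi/4\<close>.  This prevents cancellation in all the sums of
  square roots that occur as denominators below.
\<close>

lemma norm_csqrt_le_Re:
  assumes "0 < Re z"
  shows "cmod (csqrt z) \<le> 2 * Re (csqrt z)"
proof -
  have r: "0 < Re (csqrt z)" using Re_csqrt_pos[OF assms] .
  have "Re ((csqrt z)\<^sup>2) > 0" using assms by simp
  then have "(Im (csqrt z))\<^sup>2 < (Re (csqrt z))\<^sup>2" by (simp add: Re_power2 del: power2_csqrt)
  then have "\<bar>Im (csqrt z)\<bar> \<le> Re (csqrt z)"
    using r abs_le_square_iff[of "Im (csqrt z)" "Re (csqrt z)"] by simp
  with r show ?thesis using cmod_le[of "csqrt z"] by linarith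
qed

lemma norm_csqrt_add_ge:
  assumes "0 < Re z" "0 \<le> Re w"
  shows "cmod (csqrt z) / 2 \<le> cmod (csqrt z + w)"
  using norm_csqrt_le_Re[OF assms(1)] complex_Re_le_cmod[of "csqrt z + w"] assms(2)
  unfolding plus_complex.sel by linarith

text \<open>
  If \<open>sqrt (1 - x)\<close> is not small compared with \<open>p\<close>, then its real part is already large enough; otherwise \<open>p\<close> dominates.  The bound
  is uniform up to the imaginary axis.
\<close>

lemma norm_add_csqrt_one_minus_ge:
  assumes "0 < Re p" "x \<in> ball 0 1"
  shows "cmod p / 4 \<le> cmod (p + csqrt (1 - x))"
proof (cases "cmod p / 2 \<le> cmod (csqrt (1 - x))")
  case True
  then show ?thesis
    using norm_csqrt_add_ge[of "1 - x" p] one_minus_div_bounds(1)[of 1 x] assms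
    by (simp add: add.commute)
next
  case False
  then show ?thesis using norm_diff_ineq[of p "csqrt (1 - x)"] norm_ge_zero[of p] by linarith
qed

lemma tame_branch_sqrt:
  fixes \<beta> :: "'a \<Rightarrow> complex"
  assumes \<beta>: "\<And>p. p \<in> K \<Longrightarrow> 1 \<le> cmod (\<beta> p)"
    and W: "\<And>p x. p \<in> K \<Longrightarrow> x \<in> ball 0 1 \<Longrightarrow> 1 \<le> W p x"
    and low: "\<And>p x. p \<in> K \<Longrightarrow> x \<in> ball 0 1 \<Longrightarrow> inverse (sqrt (cmod (1 - x / \<beta> p))) \<le> W p x"
  shows "tame K W (\<lambda>p. branch_sqrt (\<beta> p))"
proof (rule tameI[where F' = "\<lambda>p x. - (inverse (\<beta> p) * inverse (branch_sqrt (\<beta> p) x)) / 2"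
      and F'' = "\<lambda>p x. - (inverse (\<beta> p) ^ 2 * inverse (branch_sqrt (\<beta> p) x) ^ 3) / 4"
      and C = 2 and C' = 1 and C'' = 1])
  fix p x assume p: "p \<in> K" and x: "x \<in> ball (0::complex) 1"
  note b = one_minus_div_bounds[OF \<beta>[OF p] x]
  have slit: "1 - x / \<beta> p \<notin> \<real>\<^sub>\<le>\<^sub>0" using b(1) by (auto simp: complex_nonpos_Reals_iff)
  have nz: "branch_sqrt (\<beta> p) x \<noteq> 0" "\<beta> p \<noteq> 0" using b(1) \<beta>[OF p] by (auto simp: branch_sqrt_def)
  show D: "(branch_sqrt (\<beta> p) has_field_derivative - (inverse (\<beta> p) * inverse (branch_sqrt (\<beta> p) x)) / 2) (at x)"
    unfolding branch_sqrt_def using slit nz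
    by (auto intro!: derivative_eq_intros has_field_derivative_csqrt' simp: field_simps branch_sqrt_def)
  show "((\<lambda>x. - (inverse (\<beta> p) * inverse (branch_sqrt (\<beta> p) x)) / 2) has_field_derivative
      - (inverse (\<beta> p) ^ 2 * inverse (branch_sqrt (\<beta> p) x) ^ 3) / 4) (at x)"
    using DERIV_cmult[OF DERIV_inverse'[OF D nz(1)], of "- (inverse (\<beta> p) / 2)"]
    by (simp add: power2_eq_square power3_eq_cube mult_ac)
  have "sqrt (cmod (1 - x / \<beta> p)) \<le> 2"
    using b(2) by (intro real_le_lsqrt) auto
  then show "cmod (branch_sqrt (\<beta> p) x) \<le> 2" by (simp add: branch_sqrt_def)
  have inv: "cmod (inverse (branch_sqrt (\<beta> p) x)) \<le> W p x"
    using low[OF p x] by (simp add: branch_sqrt_def norm_inverse)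
  have inv\<beta>: "cmod (inverse (\<beta> p)) \<le> 1"
    using \<beta>[OF p] by (simp add: norm_inverse inverse_le_1_iff)
  have "cmod (inverse (\<beta> p)) * cmod (inverse (branch_sqrt (\<beta> p) x)) \<le> 1 * W p x"
    using inv inv\<beta> by (intro mult_mono) auto
  then show "cmod (- (inverse (\<beta> p) * inverse (branch_sqrt (\<beta> p) x)) / 2) \<le> 1 * W p x"
    using W[OF p x] by (simp add: norm_mult norm_divide)
  define X Y where "X = cmod (inverse (\<beta> p)) ^ 2 * cmod (inverse (branch_sqrt (\<beta> p) x)) ^ 3"
    and "Y = W p x ^ 3"
  have "X \<le> 1 ^ 2 * Y"
    unfolding X_def Y_def using inv inv\<beta> by (intro mult_mono power_mono) auto
  moreover have "0 \<le> Y" using W[OF p x] by (simp add: Y_def)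
  ultimately have "X / 4 \<le> 1 * Y" by simp
  then have "cmod (inverse (\<beta> p)) ^ 2 * cmod (inverse (branch_sqrt (\<beta> p) x)) ^ 3 / 4 \<le> 1 * W p x ^ 3"
    by (simp only: X_def Y_def)
  then show "cmod (- (inverse (\<beta> p) ^ 2 * inverse (branch_sqrt (\<beta> p) x) ^ 3) / 4) \<le> 1 * W p x ^ 3"
    by (simp only: norm_minus_cancel norm_divide norm_mult norm_power norm_numeral)
qed (rule W)

definition param_region :: "real \<Rightarrow> real \<Rightarrow> complex set" where
  "param_region \<epsilon> R = {p. 0 < Re p \<and> \<epsilon> \<le> cmod p \<and> cmod p \<le> R \<and> 1 \<le> cmod (1 - p\<^sup>2)}"

text \<open>
  With \<open>A = sqrt (1 - x)\<close>, \<open>B = sqrt (1 - x / b)\<close>, \<open>S = sqrt (p + A)\<close> and \<open>b = 1 - p\<^sup>2\<close>, this is the quotient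
  \<open>(S A - S\<^sub>0 p) / (b B\<^sup>2)\<close>, where \<open>S\<^sub>0 = sqrt (2 p)\<close> and \<open>S\<^sub>0 p\<close> is the value of \<open>S A\<close> at \<open>x = b\<close>.  The factor \<open>A - p\<close>
  of \<open>b B\<^sup>2 = (A - p) (A + p)\<close> has been cancelled, so that no vanishing denominator is left.
\<close>

definition rem_at_branch :: "complex \<Rightarrow> complex \<Rightarrow> complex" where
  "rem_at_branch p x = (let S = csqrt (p + branch_sqrt 1 x) in
     (S + p * inverse (S + csqrt (2 * p))) * inverse (p + branch_sqrt 1 x))"

text \<open>
  In the same notation, with \<open>B\<^sub>1\<close> the value of \<open>B\<close> at \<open>x = 1\<close>, this is the quotient \<open>(S B - sqrt p B\<^sub>1) / A\<close>, where
  \<open>sqrt p B\<^sub>1\<close> is the value of \<open>S B\<close> at \<open>x = 1\<close>; the zero \<open>A\<close> has been cancelled by rationalising the two differences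
  \<open>B - B\<^sub>1\<close> and \<open>S - sqrt p\<close>.
\<close>

definition rem_at_one :: "complex \<Rightarrow> complex \<Rightarrow> complex" where
  "rem_at_one p x = (let S = csqrt (p + branch_sqrt 1 x); B1 = branch_sqrt (1 - p\<^sup>2) 1 in
     inverse (1 - p\<^sup>2) * (S * branch_sqrt 1 x * inverse (branch_sqrt (1 - p\<^sup>2) x + B1)) + B1 * inverse (S + csqrt p))"

definition gen_rem :: "complex \<Rightarrow> complex \<Rightarrow> complex" where
  "gen_rem p x = ((1 - p\<^sup>2) / p\<^sup>2) * (branch_sqrt (1 - p\<^sup>2) x * rem_at_branch p x + (-1) * rem_at_one p x)"

text \<open>
  The remainder is built from the two square roots by sums, products, one more square root and inverses.  Each denominator is bounded
  away from zero: \<open>\<bar>p + A\<bar> \<ge> \<bar>p\<bar> / 4\<close>, and the sums of square roots have all summands in the right half-plane.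
\<close>

lemma tame_gen_rem:
  assumes \<epsilon>: "0 < \<epsilon>"
  shows "tame (param_region \<epsilon> R) (\<lambda>p. weight (1 - p\<^sup>2)) gen_rem"
proof -
  let ?K = "param_region \<epsilon> R" and ?W = "\<lambda>p. weight (1 - p\<^sup>2)"
  have K: "0 < Re p" "\<epsilon> \<le> cmod p" "cmod p \<le> R" "1 \<le> cmod (1 - p\<^sup>2)" "p \<noteq> 0" if "p \<in> ?K" for p
    using that \<epsilon> by (auto simp: param_region_def)
  have W: "\<forall>p\<in>?K. \<forall>x\<in>ball 0 1. 1 \<le> ?W p x"
    using weight_ge_1 K(4) by blast
  note const = tame_const[OF W] and add = tame_add[OF W] and mult = tame_mult[OF W]
    and inv = tame_inverse[OF W] and sqrt = tame_csqrt[OF W]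
  have A: "tame ?K ?W (\<lambda>p. branch_sqrt 1)"
  proof (rule tame_branch_sqrt[of _ "\<lambda>_. 1"])
    show "inverse (sqrt (cmod (1 - x / 1))) \<le> ?W p x" for p x by (simp add: weight_def)
  qed (use W in auto)
  have B: "tame ?K ?W (\<lambda>p. branch_sqrt (1 - p\<^sup>2))"
  proof (rule tame_branch_sqrt[of _ "\<lambda>p. 1 - p\<^sup>2"])
    show "inverse (sqrt (cmod (1 - x / (1 - p\<^sup>2)))) \<le> ?W p x" for p x by (simp add: weight_def)
  qed (use W K in auto)
  have p: "tame ?K ?W (\<lambda>p x. p)"
    by (rule const[of "\<lambda>p. p" R]) (use K in auto)
  have pA: "tame ?K ?W (\<lambda>p x. p + branch_sqrt 1 x)" by (rule add[OF p A])
  have pA_low: "\<epsilon> / 4 \<le> cmod (p + branch_sqrt 1 x)" if "p \<in> ?K" "x \<in> ball 0 1" for p x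
    using norm_add_csqrt_one_minus_ge[of p x] K[OF that(1)] that(2) by (simp add: branch_sqrt_def)
  have ReA: "0 < Re (branch_sqrt b x)" if "1 \<le> cmod b" "x \<in> ball 0 1" for b x
    unfolding branch_sqrt_def by (rule Re_csqrt_pos[OF one_minus_div_bounds(1)[OF that]])
  have RepA: "0 < Re (p + branch_sqrt 1 x)" if "p \<in> ?K" "x \<in> ball 0 1" for p x
    using K(1)[OF that(1)] ReA[of 1 x] that by simp
  have S: "tame ?K ?W (\<lambda>p x. csqrt (p + branch_sqrt 1 x))"
  proof (rule sqrt[OF pA, of "\<epsilon> / 4"])
    show "p + branch_sqrt 1 x \<notin> \<real>\<^sub>\<le>\<^sub>0" if "p \<in> ?K" "x \<in> ball 0 1" for p x
      using RepA[OF that] by (auto simp: complex_nonpos_Reals_iff)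
  qed (use pA_low \<epsilon> in auto)
  have Sadd_low: "sqrt (\<epsilon> / 4) / 2 \<le> cmod (csqrt (p + branch_sqrt 1 x) + w)"
    if "p \<in> ?K" "x \<in> ball 0 1" "0 \<le> Re w" for p x w
    using norm_csqrt_add_ge[OF RepA[OF that(1,2)] that(3)] pA_low[OF that(1,2)]
      real_sqrt_le_mono[OF pA_low[OF that(1,2)]] unfolding norm_csqrt by linarith
  have Sinv: "tame ?K ?W (\<lambda>p x. inverse (csqrt (p + branch_sqrt 1 x) + csqrt (c * p)))" if "0 < Re c" "c \<in> \<real>" for c
  proof (rule inv[OF add[OF S const[of "\<lambda>p. csqrt (c * p)" "sqrt (cmod c * R)"]], of "sqrt (\<epsilon> / 4) / 2"])
    show "cmod (csqrt (c * p)) \<le> sqrt (cmod c * R)" if "p \<in> ?K" for p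
      using K(3)[OF that] by (auto simp: norm_mult intro!: mult_left_mono)
    show "sqrt (\<epsilon> / 4) / 2 \<le> cmod (csqrt (p + branch_sqrt 1 x) + csqrt (c * p))"
      if "p \<in> ?K" "x \<in> ball 0 1" for p x
      using csqrt_principal[of "c * p"] by (intro Sadd_low that) auto
  qed (use \<epsilon> in auto)
  have B1: "branch_sqrt (1 - p\<^sup>2) 1 = csqrt (1 - 1 / (1 - p\<^sup>2))" for p by (simp add: branch_sqrt_def)
  have n0: "1 - p\<^sup>2 \<noteq> 0" if "p \<in> ?K" for p using K(4)[OF that] by auto
  have B1eq: "1 - 1 / (1 - p\<^sup>2) = - p\<^sup>2 / (1 - p\<^sup>2)" if "p \<in> ?K" for p
    using n0[OF that] by (simp add: field_simps)
  have n_le: "cmod (1 - p\<^sup>2) \<le> 1 + R\<^sup>2" if "p \<in> ?K" for p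
    using norm_triangle_ineq4[of 1 "p\<^sup>2"] power_mono[OF K(3)[OF that], of 2] by (simp add: norm_power)
  have pp: "\<epsilon>\<^sup>2 \<le> cmod (p\<^sup>2)" if "p \<in> ?K" for p
    using power_mono[OF K(2)[OF that], of 2] \<epsilon> by (simp add: norm_power)
  have pp2: "cmod (p\<^sup>2) \<le> R\<^sup>2" if "p \<in> ?K" for p
    using power_mono[OF K(3)[OF that], of 2] \<epsilon> by (simp add: norm_power)
  have B1_le: "cmod (branch_sqrt (1 - p\<^sup>2) 1) \<le> sqrt (R\<^sup>2)" if "p \<in> ?K" for p
  proof -
    have "cmod (p\<^sup>2) / cmod (1 - p\<^sup>2) \<le> cmod (p\<^sup>2) / 1"
      using K(4)[OF that] by (intro divide_left_mono) auto
    then show ?thesis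
      unfolding B1 norm_csqrt B1eq[OF that] using pp2[OF that] by (intro real_sqrt_le_mono) (simp add: norm_divide)
  qed
  have B1_ge: "sqrt (\<epsilon>\<^sup>2 / (1 + R\<^sup>2)) \<le> cmod (branch_sqrt (1 - p\<^sup>2) 1)" if "p \<in> ?K" for p
    unfolding B1 norm_csqrt B1eq[OF that]
    using pp[OF that] n_le[OF that] K(4)[OF that]
    by (intro real_sqrt_le_mono) (auto simp: norm_divide intro!: frac_le)
  have ReB1: "0 < Re (1 - 1 / (1 - p\<^sup>2))" if "p \<in> ?K" for p
  proof -
    let ?y = "1 / (1 - p\<^sup>2)"
    have y: "cmod ?y \<le> 1" using K(4)[OF that] by (auto simp: norm_divide divide_le_eq)
    \<comment> \<open>On the closed unit disc the real part is \<open>1\<close> only at \<open>1\<close>, which would mean \<open>p = 0\<close>.\<close>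
    have "Re ?y \<noteq> 1"
    proof
      assume 1: "Re ?y = 1"
      then have "Im ?y = 0"
        using y power_mono[OF y, of 2] by (simp add: cmod_power2)
      with 1 have "?y = 1" by (simp add: complex_eq_iff)
      then show False using n0[OF that] K(5)[OF that] by simp
    qed
    then show ?thesis using complex_Re_le_cmod[of ?y] y by simp
  qed
  have Binv: "tame ?K ?W (\<lambda>p x. inverse (branch_sqrt (1 - p\<^sup>2) x + branch_sqrt (1 - p\<^sup>2) 1))"
  proof (rule inv[OF add[OF B const[of "\<lambda>p. branch_sqrt (1 - p\<^sup>2) 1", OF B1_le]], of "sqrt (\<epsilon>\<^sup>2 / (1 + R\<^sup>2)) / 2"])
    show "0 < sqrt (\<epsilon>\<^sup>2 / (1 + R\<^sup>2)) / 2" using \<epsilon> by (simp add: add_pos_nonneg)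
    fix p x assume px: "p \<in> ?K" "x \<in> ball (0::complex) 1"
    show "sqrt (\<epsilon>\<^sup>2 / (1 + R\<^sup>2)) / 2 \<le> cmod (branch_sqrt (1 - p\<^sup>2) x + branch_sqrt (1 - p\<^sup>2) 1)"
      using norm_csqrt_add_ge[OF ReB1[OF px(1)] less_imp_le[OF ReA[OF K(4)[OF px(1)] px(2)]]] B1_ge[OF px(1)]
      unfolding B1 by (subst add.commute) linarith
  qed
  have rem_at_branch: "tame ?K ?W rem_at_branch"
    unfolding rem_at_branch_def[abs_def] Let_def
    using Sinv[of 2] by (intro mult add S p inv[OF pA, of "\<epsilon> / 4"] pA_low) (use \<epsilon> in auto)
  have rem_at_one: "tame ?K ?W rem_at_one"
    unfolding rem_at_one_def[abs_def] Let_def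
    using Sinv[of 1] by (intro mult add S A Binv const[OF B1_le] const[where C = 1])
      (auto simp: norm_inverse inverse_le_1_iff K)
  have factor: "tame ?K ?W (\<lambda>p x. (1 - p\<^sup>2) / p\<^sup>2)"
  proof (rule const[where C = "(1 + R\<^sup>2) / \<epsilon>\<^sup>2"])
    show "cmod ((1 - p\<^sup>2) / p\<^sup>2) \<le> (1 + R\<^sup>2) / \<epsilon>\<^sup>2" if "p \<in> ?K" for p
      unfolding norm_divide using n_le[OF that] pp[OF that] \<epsilon> by (intro frac_le) auto
  qed
  have minus: "tame ?K ?W (\<lambda>p x. -1)"
    by (rule const[where C = 1]) simp
  show ?thesis
    unfolding gen_rem_def[abs_def] by (intro mult add B rem_at_branch rem_at_one factor minus)
qed

section \<open>The generating function\<close>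

text \<open>
  The branch of \<open>sqrt ((1 - p) / ((1 - x) (sqrt (1 - x) - p)))\<close> with value \<open>1\<close> at \<open>0\<close>, written with principal roots whose cuts
  do not meet the unit disc.
\<close>

definition gen_fun :: "complex \<Rightarrow> complex \<Rightarrow> complex" where
  "gen_fun p x = csqrt (p + branch_sqrt 1 x) / (csqrt (1 + p) * branch_sqrt 1 x * branch_sqrt (1 - p\<^sup>2) x)"

lemma
  assumes "1 \<le> cmod b" "x \<in> ball 0 1"
  shows Re_branch_sqrt_pos: "0 < Re (branch_sqrt b x)"
    and branch_sqrt_nonzero: "branch_sqrt b x \<noteq> 0"
    and branch_sqrt_squared: "(branch_sqrt b x)\<^sup>2 = 1 - x / b"
proof -
  show "0 < Re (branch_sqrt b x)"
    unfolding branch_sqrt_def by (rule Re_csqrt_pos[OF one_minus_div_bounds(1)[OF assms]])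
  then show "branch_sqrt b x \<noteq> 0" by auto
qed (simp add: branch_sqrt_def)

text \<open>
  The identity \<open>A\<^sup>2 - b B\<^sup>2 = p\<^sup>2\<close> is a partition of unity that separates the singularities:
  \<open>p\<^sup>2 S / (A B) = S A / B - b S B / A\<close>, where the first term is bounded at \<open>x = 1\<close> and the second one at \<open>x = b\<close>.  Subtracting from \<open>S A\<close>
  and \<open>S B\<close> their values at the zero of the denominator leaves the remainder.
\<close>

lemma gen_decomposition:
  assumes p: "0 < Re p" "1 \<le> cmod (1 - p\<^sup>2)" and x: "x \<in> ball 0 1"
  shows "csqrt (p + branch_sqrt 1 x) / (branch_sqrt 1 x * branch_sqrt (1 - p\<^sup>2) x)
    = csqrt p / branch_sqrt (1 - p\<^sup>2) 1 * inverse (branch_sqrt 1 x)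
      + csqrt (2 * p) / p * inverse (branch_sqrt (1 - p\<^sup>2) x) + gen_rem p x"
proof -
  define b where "b = 1 - p\<^sup>2"
  define A where "A = branch_sqrt 1 x"
  define B where "B = branch_sqrt b x"
  define B1 where "B1 = branch_sqrt b 1"
  define S where "S = csqrt (p + A)"
  define s where "s = csqrt p"
  define S0 where "S0 = csqrt (2 * p)"
  have b0: "b \<noteq> 0" "1 \<le> cmod b" using p(2) by (auto simp: b_def)
  have p0: "p \<noteq> 0" using p by auto
  have A: "A \<noteq> 0" "0 < Re A" "A\<^sup>2 = 1 - x"
    using branch_sqrt_nonzero[of 1 x] Re_branch_sqrt_pos[of 1 x] branch_sqrt_squared[of 1 x] x by (auto simp: A_def)
  have B: "B \<noteq> 0" "0 < Re B" "B\<^sup>2 = 1 - x / b"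
    using branch_sqrt_nonzero[OF b0(2) x] Re_branch_sqrt_pos[OF b0(2) x] branch_sqrt_squared[OF b0(2) x] by (auto simp: B_def)
  have bB: "b * B\<^sup>2 = A\<^sup>2 - p\<^sup>2"
    using b0 by (simp add: A B) (simp add: field_simps b_def)
  have B1: "B1\<^sup>2 = 1 - 1 / b" by (simp add: B1_def branch_sqrt_def)
  have bB1: "b * B1\<^sup>2 = - p\<^sup>2"
    using b0 by (simp add: B1) (simp add: field_simps b_def)
  have B1_nz: "B1 \<noteq> 0" using bB1 p0 by auto
  have Re: "0 \<le> Re B1" "0 \<le> Re s" "0 \<le> Re S0" "0 < Re S"
    using csqrt_principal[of "1 - 1 / b"] csqrt_principal[of p] csqrt_principal[of "2 * p"]
      Re_csqrt_pos[of "p + A"] p A by (auto simp: B1_def s_def S0_def S_def branch_sqrt_def)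
  have nz: "B + B1 \<noteq> 0" "S + s \<noteq> 0" "S + S0 \<noteq> 0" "p + A \<noteq> 0"
    using Re B(2) A(2) p(1) by (auto simp: complex_eq_iff)
  have sq: "S\<^sup>2 = p + A" "s\<^sup>2 = p" "S0\<^sup>2 = 2 * p" by (simp_all add: S_def s_def S0_def)
  define K where "K = (S + p * inverse (S + S0)) * inverse (p + A)"
  define V where "V = inverse b * (S * A * inverse (B + B1)) + B1 * inverse (S + s)"
  have gen_rem: "gen_rem p x = b / p\<^sup>2 * (B * K - V)"
    by (simp add: gen_rem_def rem_at_branch_def rem_at_one_def Let_def K_def V_def S_def S0_def s_def A_def B_def B1_def b_def)
  have "(A - p) * inverse (S + S0) = S - S0"
    using nz(3) sq by (simp add: field_simps power2_eq_square)
  moreover have "(p + A) * K = S + p * inverse (S + S0)"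
    using nz(4) by (simp add: K_def)
  ultimately have 1: "S * A - S0 * p = b * B\<^sup>2 * K"
    unfolding bB by algebra
  have "A * inverse (S + s) = S - s"
    using nz(2) sq by (simp add: field_simps power2_eq_square)
  moreover have "A\<^sup>2 * (inverse b * inverse (B + B1)) = B - B1"
  proof -
    have "A\<^sup>2 = b * ((B - B1) * (B + B1))" using bB bB1 by algebra
    moreover have "b * (u * w) * (inverse b * inverse w) = u" if "w \<noteq> 0" for u w
      using b0 that by (simp add: field_simps)
    ultimately show ?thesis using nz(1) by metis
  qed
  ultimately have 2: "S * B - s * B1 = A * V"
    unfolding V_def by algebra
  have "p\<^sup>2 * S = S * A\<^sup>2 - b * (S * B\<^sup>2)" using bB by algebra
  also have "\<dots> = A * B\<^sup>2 * b * K + A * S0 * p - b * B * (A * V) - b * B * s * B1"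
    using 1 2 by algebra
  finally have num: "p\<^sup>2 * S = A * B\<^sup>2 * b * K + A * S0 * p - b * B * (A * V) - b * B * s * B1" .
  have "S / (A * B) = (p\<^sup>2 * S) / (p\<^sup>2 * (A * B))" using p0 by simp
  also have "\<dots> = (- b * B1 / p\<^sup>2) * s * inverse A + S0 / p * inverse B + b / p\<^sup>2 * (B * K - V)"
    unfolding num using p0 A(1) B(1) by (simp add: field_simps power2_eq_square)
  also have "- b * B1 / p\<^sup>2 = inverse B1"
    using bB1 p0 B1_nz by (simp add: field_simps power2_eq_square)
  finally show ?thesis
    by (simp add: gen_rem S_def A_def B_def B1_def s_def S0_def b_def divide_inverse mult_ac)
qed

text \<open>
  The Taylor coefficients of \<open>1 / sqrt (1 - x)\<close>.
\<close>

definition central_ratio :: "nat \<Rightarrow> real" where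
  "central_ratio m = real ((2 * m) choose m) / 4 ^ m"

lemma central_ratio_eq_pochhammer: "central_ratio m = pochhammer (1/2) m / fact m"
proof -
  have "real ((2 * m) choose m) = fact (2 * m) / (fact m * fact m)"
    by (subst binomial_fact) auto
  then show ?thesis
    unfolding central_ratio_def fact_double by (simp add: power_mult)
qed

text \<open>
  Induction with the ratio \<open>(m + 1/2) / (m + 1)\<close> of consecutive terms, which exceeds \<open>sqrt (m / (m + 1))\<close>.
\<close>

lemma central_ratio_lower_bound:
  assumes "1 \<le> m"
  shows "1 / (2 * sqrt (real m)) \<le> central_ratio m"
  using assms
proof (induction rule: dec_induct)
  case base
  then show ?case by (simp add: central_ratio_eq_pochhammer)
next
  case (step m)
  have m: "0 < real m" using step by simp
  have "real m * real (Suc m) \<le> (real m + 1/2)\<^sup>2" by (simp add: power2_eq_square algebra_simps)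
  then have "sqrt (real m) * sqrt (real (Suc m)) \<le> real m + 1/2"
    unfolding real_sqrt_mult[symmetric] by (intro real_le_lsqrt) auto
  then have le: "sqrt (real m) * sqrt (real (Suc m)) \<le> real m + 1/2" .
  have "1 / (2 * v) = 1 / (2 * u) * ((u * v) / (v * v))" if "0 < u" "0 < v" for u v :: real
    using that by (simp add: field_simps)
  from this[of "sqrt (real m)" "sqrt (real (Suc m))"] m
  have "1 / (2 * sqrt (real (Suc m))) = 1 / (2 * sqrt (real m)) * ((sqrt (real m) * sqrt (real (Suc m))) / real (Suc m))"
    by simp
  also have "\<dots> \<le> 1 / (2 * sqrt (real m)) * ((real m + 1/2) / real (Suc m))"
    using le by (intro mult_left_mono divide_right_mono) auto
  also have "\<dots> \<le> central_ratio m * ((real m + 1/2) / real (Suc m))"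
    using step by (intro mult_right_mono) auto
  also have "\<dots> = central_ratio (Suc m)"
    by (simp add: central_ratio_eq_pochhammer pochhammer_Suc add.commute)
  finally show ?case .
qed

lemma inverse_branch_sqrt_has_fps_expansion:
  assumes "b \<noteq> 0"
  shows "(\<lambda>x. inverse (branch_sqrt b x)) has_fps_expansion Abs_fps (\<lambda>m. of_real (central_ratio m) * inverse b ^ m)"
proof -
  define c where "c = - inverse b"
  have "((\<lambda>y. (1 + y) powr (- 1/2)) \<circ> (\<lambda>x. c * x)) has_fps_expansion (fps_binomial (- 1/2) oo (fps_const c * fps_X))"
    by (intro has_fps_expansion_compose has_fps_expansion_binomial_complex has_fps_expansion_cmult_left
          has_fps_expansion_fps_X) simp
  also have "(\<lambda>y. (1 + y) powr (- 1/2)) \<circ> (\<lambda>x. c * x) = (\<lambda>x. inverse (branch_sqrt b x))"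
  proof
    fix x
    have "1 + c * x = 1 - x / b" by (simp add: c_def divide_inverse mult.commute)
    then show "((\<lambda>y. (1 + y) powr (- 1/2)) \<circ> (\<lambda>x. c * x)) x = inverse (branch_sqrt b x)"
      by (simp add: branch_sqrt_def csqrt_conv_powr powr_minus)
  qed
  also have "fps_binomial (- 1/2) oo (fps_const c * fps_X) = Abs_fps (\<lambda>m. of_real (central_ratio m) * inverse b ^ m)"
  proof (rule fps_ext)
    fix m
    have "of_real (central_ratio m) = (pochhammer (1/2) m / fact m :: complex)"
      by (simp add: central_ratio_eq_pochhammer flip: pochhammer_of_real)
    moreover have "c ^ m = (- 1) ^ m * inverse b ^ m"
      unfolding c_def by (rule power_minus)
    moreover have "(- 1) ^ m * (- 1) ^ m = (1 :: complex)"
      by (simp flip: power_mult_distrib)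
    ultimately show "fps_nth (fps_binomial (- 1/2) oo (fps_const c * fps_X)) m
        = fps_nth (Abs_fps (\<lambda>m. of_real (central_ratio m) * inverse b ^ m)) m"
      unfolding fps_compose_linear fps_nth_Abs_fps fps_binomial_nth gbinomial_pochhammer
      by simp
  qed
  finally show ?thesis .
qed

lemma gen_rem_holomorphic:
  assumes "0 < Re p" "1 \<le> cmod (1 - p\<^sup>2)"
  shows "gen_rem p holomorphic_on ball 0 1"
proof -
  have "p \<noteq> 0" using assms by auto
  \<comment> \<open>A single parameter: both bounds for the modulus are chosen to be \<open>\<bar>p\<bar>\<close>.\<close>
  then have "tame (param_region (cmod p) (cmod p)) (\<lambda>p. weight (1 - p\<^sup>2)) gen_rem"
    by (intro tame_gen_rem) simp
  moreover have "p \<in> param_region (cmod p) (cmod p)" using assms by (simp add: param_region_def)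
  ultimately show ?thesis
    unfolding holomorphic_on_open[OF open_ball] by (elim tameE) blast
qed

lemma gen_has_fps_expansion:
  assumes p: "0 < Re p" "1 \<le> cmod (1 - p\<^sup>2)"
  obtains g where "gen_fun p has_fps_expansion g"
    "\<And>m. fps_nth g m = (csqrt p / branch_sqrt (1 - p\<^sup>2) 1 * of_real (central_ratio m)
        + csqrt (2 * p) / p * (of_real (central_ratio m) * inverse (1 - p\<^sup>2) ^ m)
        + (deriv ^^ m) (gen_rem p) 0 / fact m) / csqrt (1 + p)"
proof -
  define I where "I b = Abs_fps (\<lambda>m. of_real (central_ratio m) * inverse b ^ m :: complex)" for b
  define g where "g = (fps_const (csqrt p / branch_sqrt (1 - p\<^sup>2) 1) * I 1
      + fps_const (csqrt (2 * p) / p) * I (1 - p\<^sup>2) + fps_expansion (gen_rem p) 0)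
      * fps_const (inverse (csqrt (1 + p)))"
  have b0: "1 - p\<^sup>2 \<noteq> 0" using p by auto
  have R: "gen_rem p has_fps_expansion fps_expansion (gen_rem p) 0"
    by (rule has_fps_expansion_fps_expansion[OF open_ball _ gen_rem_holomorphic[OF p]]) simp
  have "(\<lambda>x. (csqrt p / branch_sqrt (1 - p\<^sup>2) 1 * inverse (branch_sqrt 1 x)
      + csqrt (2 * p) / p * inverse (branch_sqrt (1 - p\<^sup>2) x) + gen_rem p x) * inverse (csqrt (1 + p))) has_fps_expansion g"
    unfolding g_def I_def
    by (intro has_fps_expansion_add has_fps_expansion_cmult_left has_fps_expansion_cmult_right
        inverse_branch_sqrt_has_fps_expansion R b0) simp_all
  moreover have "eventually (\<lambda>x. x \<in> ball 0 1) (nhds (0::complex))"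
    by (rule eventually_nhds_in_open) auto
  then have "eventually (\<lambda>x. gen_fun p x = (csqrt p / branch_sqrt (1 - p\<^sup>2) 1 * inverse (branch_sqrt 1 x)
      + csqrt (2 * p) / p * inverse (branch_sqrt (1 - p\<^sup>2) x) + gen_rem p x) * inverse (csqrt (1 + p))) (nhds 0)"
  proof eventually_elim
    case (elim x)
    show ?case
      unfolding gen_decomposition[OF p elim, symmetric] by (simp add: gen_fun_def divide_inverse mult_ac)
  qed
  ultimately have "gen_fun p has_fps_expansion g"
    by (subst has_fps_expansion_cong[OF _ refl])
  then show ?thesis
    by (rule that) (simp add: g_def I_def fps_expansion_def divide_inverse mult_ac)
qed

text \<open>
  The factor \<open>p + A\<close> in the square of the generating function cancels against \<open>b B\<^sup>2 = (A - p) (A + p)\<close>, which leaves the equation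
  required by \<open>jacobi_sum_eq_fps_nth\<close>.
\<close>

lemma jacobi_sum_eq_gen_coefficient:
  assumes p: "0 < Re p" "1 \<le> cmod (1 - p\<^sup>2)" and g: "gen_fun p has_fps_expansion g"
  shows "(\<Sum>k=0..m. ((2 * of_nat m + 1/2) gchoose (m - k)) * ((- 1/2) gchoose k)
            * (- (1 + p) / (1 - p)) ^ k) = 4 ^ m * fps_nth g m"
proof -
  have ev: "eventually (\<lambda>x. x \<in> ball 0 1) (nhds (0::complex))"
    by (rule eventually_nhds_in_open) auto
  have b0: "1 - p\<^sup>2 \<noteq> 0" using p by auto
  have p1: "p \<noteq> 1" using b0 by auto
  have v0: "1 + p \<noteq> 0" using p by (auto simp: complex_eq_iff)
  have "branch_sqrt 1 holomorphic_on ball 0 1"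
    unfolding branch_sqrt_def
    by (intro holomorphic_intros) (use one_minus_div_bounds(1)[of 1] in \<open>force simp: complex_nonpos_Reals_iff\<close>)+
  then have Q: "branch_sqrt 1 has_fps_expansion fps_expansion (branch_sqrt 1) 0" (is "_ has_fps_expansion ?Q")
    by (intro has_fps_expansion_fps_expansion[OF open_ball]) auto
  show ?thesis
  proof (rule jacobi_sum_eq_fps_nth[OF p1])
    have "(\<lambda>x. (branch_sqrt 1 x)\<^sup>2) has_fps_expansion ?Q ^ 2"
      by (rule has_fps_expansion_power[OF Q])
    moreover have "(\<lambda>x. (branch_sqrt 1 x)\<^sup>2) = (\<lambda>x. 1 - x)"
      by (simp add: branch_sqrt_def)
    moreover have "(\<lambda>x::complex. 1 - x) has_fps_expansion 1 - fps_X"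
      by (intro fps_expansion_intros)
    ultimately show "?Q ^ 2 = 1 - fps_X"
      by (metis fps_expansion_unique_complex)
    show "fps_nth ?Q 0 = 1"
      using has_fps_expansion_imp_0_eq_fps_nth_0[OF Q] by (simp add: branch_sqrt_def)
    have "gen_fun p 0 = 1" using v0 by (simp add: gen_fun_def branch_sqrt_def add.commute)
    then show "fps_nth g 0 = 1"
      using has_fps_expansion_imp_0_eq_fps_nth_0[OF g] by simp
    have "(\<lambda>x. (gen_fun p x)\<^sup>2 * (1 - x) * (branch_sqrt 1 x - p)) has_fps_expansion g ^ 2 * (1 - fps_X) * (?Q - fps_const p)"
      by (intro fps_expansion_intros has_fps_expansion_power g Q)
    moreover have "eventually (\<lambda>x. (gen_fun p x)\<^sup>2 * (1 - x) * (branch_sqrt 1 x - p) = 1 - p) (nhds 0)"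
      using ev
    proof eventually_elim
      case (elim x)
      define A where "A = branch_sqrt 1 x"
      define B where "B = branch_sqrt (1 - p\<^sup>2) x"
      have A: "A \<noteq> 0" "A\<^sup>2 = 1 - x" "0 < Re A"
        using branch_sqrt_nonzero[of 1 x] branch_sqrt_squared[of 1 x] Re_branch_sqrt_pos[of 1 x] elim by (auto simp: A_def)
      have B: "B \<noteq> 0" "B\<^sup>2 = 1 - x / (1 - p\<^sup>2)"
        using branch_sqrt_nonzero[OF p(2) elim] branch_sqrt_squared[OF p(2) elim] by (auto simp: B_def)
      have bB: "(1 - p\<^sup>2) * B\<^sup>2 = (A - p) * (A + p)"
      proof -
        have "(1 - p\<^sup>2) * B\<^sup>2 = 1 - p\<^sup>2 - x" using b0 by (simp add: B right_diff_distrib)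
        also have "\<dots> = A\<^sup>2 - p\<^sup>2" by (simp add: A)
        also have "\<dots> = (A - p) * (A + p)" by algebra
        finally show ?thesis .
      qed
      have "(gen_fun p x)\<^sup>2 = (p + A) / ((1 + p) * (A\<^sup>2 * B\<^sup>2))"
        unfolding gen_fun_def A_def[symmetric] B_def[symmetric]
        by (simp add: power_divide power_mult_distrib mult.assoc)
      then have "(gen_fun p x)\<^sup>2 * A\<^sup>2 * (A - p) * ((1 + p) * B\<^sup>2) = (1 - p) * ((1 + p) * B\<^sup>2)"
      proof -
        have "(gen_fun p x)\<^sup>2 * ((1 + p) * (A\<^sup>2 * B\<^sup>2)) = p + A"
          unfolding \<open>(gen_fun p x)\<^sup>2 = _\<close> using A(1) B(1) v0 by simp
        then show ?thesis using bB by algebra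
      qed
      then have "(gen_fun p x)\<^sup>2 * A\<^sup>2 * (A - p) = 1 - p"
        using v0 B(1) by simp
      then show ?case by (simp add: A(2) A_def[symmetric])
    qed
    ultimately have "(\<lambda>x. 1 - p) has_fps_expansion g ^ 2 * (1 - fps_X) * (?Q - fps_const p)"
      by (subst (asm) has_fps_expansion_cong[OF _ refl])
    then show "g ^ 2 * (1 - fps_X) * (?Q - fps_const p) = fps_const (1 - p)"
      by (rule fps_expansion_unique_complex) (rule has_fps_expansion_const)
  qed
qed

lemma central_ratio_pos: "0 < central_ratio m"
  by (simp add: central_ratio_def)

text \<open>
  An exact formula.  The three terms come from the inverse square root at \<open>1\<close>, the one at \<open>b\<close>, and the remainder; the normalisation
  \<open>kappa\<close> turns the coefficient \<open>central_ratio m\<close> of the first two into \<open>1\<close>.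
\<close>

lemma monic_P_expansion:
  assumes p: "0 < Re p" "1 \<le> cmod (1 - p\<^sup>2)"
  shows "monic_P m (- p) = (1 - p) ^ m * (csqrt p / (branch_sqrt (1 - p\<^sup>2) 1 * csqrt (1 + p))
      + csqrt (2 * p) / (p * csqrt (1 + p) * (1 - p\<^sup>2) ^ m)
      + (deriv ^^ m) (gen_rem p) 0 / fact m / (csqrt (1 + p) * of_real (central_ratio m)))"
proof -
  obtain g where g: "gen_fun p has_fps_expansion g"
    "\<And>m. fps_nth g m = (csqrt p / branch_sqrt (1 - p\<^sup>2) 1 * of_real (central_ratio m)
        + csqrt (2 * p) / p * (of_real (central_ratio m) * inverse (1 - p\<^sup>2) ^ m)
        + (deriv ^^ m) (gen_rem p) 0 / fact m) / csqrt (1 + p)"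
    using gen_has_fps_expansion[OF p] by blast
  have p1: "1 - p \<noteq> 0" using p by auto
  define a where "a k = ((2 * of_nat m + 1/2) gchoose (m - k)) * ((- 1/2) gchoose k :: complex)" for k
  have "(\<Sum>k=0..m. a k * (- p - 1) ^ k * (- p + 1) ^ (m - k))
      = (\<Sum>k=0..m. (1 - p) ^ m * (a k * (- (1 + p) / (1 - p)) ^ k))"
  proof (intro sum.cong refl)
    fix k assume "k \<in> {0..m}"
    then have pw: "(1 - p) ^ m = (1 - p) ^ k * (1 - p) ^ (m - k)" by (simp flip: power_add)
    have e: "- p - 1 = - (1 + p)" "- p + 1 = 1 - p" by simp_all
    have cancel: "c * d * f = h * f * (c * (d / h))" if "h \<noteq> 0" for c d f h :: complex
      using that by simp
    show "a k * (- p - 1) ^ k * (- p + 1) ^ (m - k) = (1 - p) ^ m * (a k * (- (1 + p) / (1 - p)) ^ k)"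
      unfolding e pw power_divide by (rule cancel) (use p1 in simp)
  qed
  also have "\<dots> = (1 - p) ^ m * (4 ^ m * fps_nth g m)"
    unfolding sum_distrib_left[symmetric] a_def jacobi_sum_eq_gen_coefficient[OF p g(1)] ..
  finally have "jacobi_P m (- p) = 1 / 2 ^ m * ((1 - p) ^ m * (4 ^ m * fps_nth g m))"
    unfolding jacobi_P_def a_def by simp
  moreover have "kappa m = 1 / 2 ^ m * (4 ^ m * of_real (central_ratio m))"
    by (simp add: kappa_def central_ratio_def)
  ultimately have "monic_P m (- p) = (1 - p) ^ m * (fps_nth g m / of_real (central_ratio m))"
    unfolding monic_P_def by simp
  also have "fps_nth g m / of_real (central_ratio m) = csqrt p / (branch_sqrt (1 - p\<^sup>2) 1 * csqrt (1 + p))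
      + csqrt (2 * p) / (p * csqrt (1 + p) * (1 - p\<^sup>2) ^ m)
      + (deriv ^^ m) (gen_rem p) 0 / fact m / (csqrt (1 + p) * of_real (central_ratio m))"
  proof -
    have split: "(x * c + y * (c * w) + z) / v / c = x / v + y / v * w + z / (v * c)" if "c \<noteq> 0"
      for x y z v w c :: complex
      using that by (simp add: add_divide_distrib)
    show ?thesis
      unfolding g(2) by (subst split) (use central_ratio_pos[of m] in \<open>simp_all add: power_inverse divide_inverse mult_ac\<close>)
  qed
  finally show ?thesis .
qed

section \<open>Branches of the square roots\<close>

text \<open>
  The root with argument in \<open>[0, pi)\<close> is the principal root of \<open>- w\<close> turned by a right angle.
\<close>

lemma root_Arg2pi_eq:
  assumes "w \<notin> \<real>\<^sub>\<ge>\<^sub>0"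
  shows "of_real (sqrt (cmod w)) * exp (\<i> * of_real (Arg2pi w / 2)) = \<i> * csqrt (- w)"
proof -
  have w0: "w \<noteq> 0" using assms by auto
  have "Arg2pi w \<noteq> 0"
    using assms unfolding Arg2pi_eq_0 by (auto simp: complex_nonneg_Reals_iff complex_is_Real_iff)
  then have "0 < Arg2pi w" using Arg2pi[of w] by simp
  then have "Arg2pi w = Im (Ln (- w)) + pi" by (rule Arg2pi_Ln)
  then have "exp (\<i> * of_real (Arg2pi w / 2)) = exp (\<i> * of_real (Im (Ln (- w)) / 2)) * exp (\<i> * of_real (pi / 2))"
    by (simp add: add_divide_distrib distrib_left flip: exp_add)
  also have "exp (\<i> * of_real (pi / 2)) = \<i>"
    by (metis cis_conv_exp cis_pi_half)
  finally have e: "exp (\<i> * of_real (Arg2pi w / 2)) = exp (\<i> * of_real (Im (Ln (- w)) / 2)) * \<i>" .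
  have "csqrt (- w) = exp (of_real (ln (cmod w) / 2) + \<i> * of_real (Im (Ln (- w)) / 2))"
    using w0 by (simp add: csqrt_exp_Ln complex_eq_iff exp_eq_polar)
  also have "\<dots> = of_real (sqrt (cmod w)) * exp (\<i> * of_real (Im (Ln (- w)) / 2))"
    using w0 by (simp only: exp_add exp_of_real) (simp flip: ln_sqrt)
  finally show ?thesis unfolding e by simp
qed

lemma not_nonneg_Real_if_Re_neg: "Re w < 0 \<Longrightarrow> w \<notin> \<real>\<^sub>\<ge>\<^sub>0"
  by (auto simp: complex_nonneg_Reals_iff)

lemma sqrt_z_minus: "0 < Re p \<Longrightarrow> sqrt_z (- p) = \<i> * csqrt p"
  unfolding sqrt_z_def using root_Arg2pi_eq[of "- p"] not_nonneg_Real_if_Re_neg[of "- p"] by simp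

lemma sqrt_1m_minus:
  assumes "0 < Re p"
  shows "sqrt_1m (- p) = - csqrt (1 + p)"
proof -
  have "exp (\<i> * of_real ((Arg2pi (- p - 1) + pi) / 2)) = exp (\<i> * of_real (Arg2pi (- p - 1) / 2)) * exp (\<i> * of_real (pi / 2))"
    by (simp add: add_divide_distrib distrib_left flip: exp_add)
  also have "exp (\<i> * of_real (pi / 2)) = \<i>"
    by (metis cis_conv_exp cis_pi_half)
  finally have "sqrt_1m (- p) = of_real (sqrt (cmod (- p - 1))) * exp (\<i> * of_real (Arg2pi (- p - 1) / 2)) * \<i>"
    by (simp add: sqrt_1m_def norm_minus_commute[of "- p" 1])
  also have "\<dots> = \<i> * (of_real (sqrt (cmod (- p - 1))) * exp (\<i> * of_real (Arg2pi (- p - 1) / 2)))"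
    by (rule mult.commute)
  also have "\<dots> = - csqrt (1 + p)"
    using root_Arg2pi_eq[of "- p - 1"] not_nonneg_Real_if_Re_neg[of "- p - 1"] assms
    by (simp add: add.commute)
  finally show ?thesis .
qed

text \<open>
  The cut \<open>[-1, 0]\<close> of \<open>sqrt_1p z / sqrt_z z\<close> lies inside the left loop of the lemniscate \<open>\<bar>1 - z\<^sup>2\<bar> = 1\<close>.
\<close>

lemma not_real_in_unit_interval:
  assumes "0 < Re p" "1 \<le> cmod (1 - p\<^sup>2)" "Im p = 0"
  shows "1 < Re p"
proof (rule ccontr)
  assume "\<not> 1 < Re p"
  then have r: "0 < (Re p)\<^sup>2" "(Re p)\<^sup>2 \<le> 1" using assms by (auto simp: power_le_one)
  have "1 - p\<^sup>2 = of_real (1 - (Re p)\<^sup>2)"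
    using assms(3) by (simp add: complex_eq_iff power2_eq_square)
  then have "cmod (1 - p\<^sup>2) = \<bar>1 - (Re p)\<^sup>2\<bar>" by (simp only: norm_of_real)
  with assms(2) r show False by simp
qed

lemma sqrt_1p_minus:
  assumes "0 < Re p" "1 \<le> cmod (1 - p\<^sup>2)"
  shows "sqrt_1p (- p) = \<i> * csqrt (p - 1)"
proof -
  have "1 - p \<notin> \<real>\<^sub>\<ge>\<^sub>0"
    using not_real_in_unit_interval[OF assms] by (auto simp: complex_nonneg_Reals_iff)
  from root_Arg2pi_eq[OF this] show ?thesis by (simp add: sqrt_1p_def)
qed

text \<open>
  Both sides have the same square, so the point is that the right-hand side has positive real part.  With \<open>u = csqrt (p - 1)\<close> and
  \<open>v = csqrt (1 + p)\<close> one has \<open>2 p = u\<^sup>2 + v\<^sup>2\<close>, hence \<open>p / (u v) = (t + 1 / t) / 2\<close> for \<open>t = u / v\<close>, and \<open>Re t > 0\<close> because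
  \<open>u\<close> and \<open>v\<close> lie in the same quadrant: \<open>Im p\<close> determines the sign of both imaginary parts.
\<close>

lemma branch_sqrt_at_one:
  assumes p: "0 < Re p" "1 \<le> cmod (1 - p\<^sup>2)"
  shows "branch_sqrt (1 - p\<^sup>2) 1 = p / (csqrt (p - 1) * csqrt (1 + p))"
  unfolding branch_sqrt_def
proof (rule csqrt_unique)
  define u where "u = csqrt (p - 1)"
  define v where "v = csqrt (1 + p)"
  have sq: "u\<^sup>2 = p - 1" "v\<^sup>2 = 1 + p" by (simp_all add: u_def v_def)
  have b0: "1 - p\<^sup>2 \<noteq> 0" using p by auto
  have uv0: "u \<noteq> 0" "v \<noteq> 0" using b0 by (auto simp: u_def v_def power2_eq_square add_eq_0_iff)
  have uv: "(u * v)\<^sup>2 = - (1 - p\<^sup>2)"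
    by (simp add: power_mult_distrib sq) (simp add: algebra_simps power2_eq_square)
  show "(p / (csqrt (p - 1) * csqrt (1 + p)))\<^sup>2 = 1 - 1 / (1 - p\<^sup>2)"
    unfolding u_def[symmetric] v_def[symmetric] power_divide uv using b0 by (simp add: field_simps)
  have v_pos: "0 < Re v" unfolding v_def by (rule Re_csqrt_pos) (use p in simp)
  have Imu: "2 * Re u * Im u = Im p" and Imv: "2 * Re v * Im v = Im p"
    using arg_cong[OF sq(1), of Im] arg_cong[OF sq(2), of Im] by (simp_all add: Im_power2)
  have "0 < Re u * Re v + Im u * Im v"
  proof (cases "Im p = 0")
    case True
    then have "0 < Re u" unfolding u_def
      using not_real_in_unit_interval[OF p] by (intro Re_csqrt_pos) simp
    moreover have "Im v = 0" using Imv True v_pos by simp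
    ultimately show ?thesis using v_pos by simp
  next
    case False
    then have "Re u \<noteq> 0" using Imu by auto
    then have u_pos: "0 < Re u" using csqrt_principal[of "p - 1"] by (auto simp: u_def)
    have "4 * (Re u * Re v) * (Im u * Im v) = Im p * Im p"
    proof -
      have "Im p * Im p = (2 * Re u * Im u) * (2 * Re v * Im v)" by (simp only: Imu Imv)
      then show ?thesis by algebra
    qed
    moreover have "0 < Im p * Im p" using False by (simp add: zero_less_mult_iff) linarith
    ultimately have "0 < (4 * (Re u * Re v)) * (Im u * Im v)" by simp
    then have "0 < Im u * Im v"
      by (rule zero_less_mult_pos) (use u_pos v_pos in simp)
    then show ?thesis using u_pos v_pos by (simp add: add_pos_pos)
  qed
  then have t: "0 < Re (u / v)"
    using uv0 by (simp add: Re_divide' sum_power2_gt_zero_iff complex_eq_iff)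
  have sum: "p / (u * v) = (u / v + inverse (u / v)) / 2"
  proof -
    have "2 * p = u\<^sup>2 + v\<^sup>2" by (simp add: sq)
    then show ?thesis using uv0 by (simp add: field_simps power2_eq_square)
  qed
  have "0 < Re (inverse (u / v))"
    unfolding inverse_complex.sel using t by (intro divide_pos_pos add_pos_nonneg) auto
  then have "0 < Re (p / (u * v))" unfolding sum using t by (simp del: inverse_divide)
  then show "0 < Re (p / (csqrt (p - 1) * csqrt (1 + p))) \<or>
      Re (p / (csqrt (p - 1) * csqrt (1 + p))) = 0 \<and> 0 \<le> Im (p / (csqrt (p - 1) * csqrt (1 + p)))"
    by (simp add: u_def v_def)
qed

section \<open>The region\<close>

text \<open>
  From a point with \<open>Re z \<ge> 0\<close> one escapes to infinity along the horizontal ray to the right.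
\<close>

lemma inside_subset_open_half_plane:
  assumes S: "S \<subseteq> {w. Re w \<le> 0}" and z: "z \<in> inside S"
  shows "Re z < 0"
proof (rule ccontr)
  let ?ray = "(\<lambda>t::real. z + of_real t) ` {0..}"
  assume "\<not> Re z < 0"
  have sub: "?ray \<subseteq> - S"
  proof (rule image_subsetI)
    fix t :: real assume t: "t \<in> {0..}"
    show "z + of_real t \<in> - S"
    proof (cases "t = 0")
      case True
      then show ?thesis using z by (simp add: inside_def)
    next
      case False
      with t \<open>\<not> Re z < 0\<close> have "0 < Re (z + of_real t)" by simp
      with S show ?thesis by fastforce
    qed
  qed
  have "connected ?ray"
    by (intro connected_continuous_image continuous_intros) auto
  moreover have "z \<in> ?ray" by (auto intro!: image_eqI[of _ _ 0])
  ultimately have "?ray \<subseteq> connected_component_set (- S) z"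
    using sub by (intro connected_component_maximal)
  moreover have "bounded (connected_component_set (- S) z)"
    using z by (simp add: inside_def)
  ultimately have "bounded ?ray" by (rule bounded_subset[rotated])
  then obtain B where B: "\<And>w. w \<in> ?ray \<Longrightarrow> cmod w \<le> B" by (auto simp: bounded_iff)
  have "z + of_real (\<bar>B\<bar> + cmod z + 1) \<in> ?ray" by (intro imageI) auto
  from B[OF this] have "cmod (of_real (\<bar>B\<bar> + cmod z + 1) :: complex) \<le> B + cmod z"
    using norm_diff_ineq[of "of_real (\<bar>B\<bar> + cmod z + 1)" z] by (simp add: add.commute)
  then show False unfolding norm_of_real by simp
qed

text \<open>
  The open set \<open>{w. \<bar>1 - w\<^sup>2\<bar> < 1, Re w < 0}\<close> is bounded and its boundary lies on the curve, so a component of the complement that meets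
  it is contained in it.
\<close>

lemma outside_lemniscate:
  assumes z: "z \<in> outside Sigma_m1" and Re: "Re z < 0"
  shows "1 < cmod (1 - z\<^sup>2)"
proof (rule ccontr)
  assume "\<not> ?thesis"
  moreover have "z \<notin> Sigma_m1" using z by (simp add: outside_def)
  ultimately have lt: "cmod (1 - z\<^sup>2) < 1" using Re by (simp add: Sigma_m1_def)
  let ?C = "connected_component_set (- Sigma_m1) z"
  let ?U = "{w. cmod (1 - w\<^sup>2) < 1} \<inter> {w. Re w < 0}"
  let ?V = "{w. 1 < cmod (1 - w\<^sup>2)} \<union> {w. 0 < Re w}"
  have opn: "open ?U" "open ?V"
    by (intro open_Int open_Un open_Collect_less continuous_intros)+
  have disj: "?U \<inter> ?V \<inter> ?C = {}" by auto
  have cover: "?C \<subseteq> ?U \<union> ?V"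
  proof
    fix w assume "w \<in> ?C"
    then have w: "w \<notin> Sigma_m1" using connected_component_subset by auto
    show "w \<in> ?U \<union> ?V"
    proof (cases "Re w = 0")
      case True
      then have "1 - w\<^sup>2 = of_real (1 + (Im w)\<^sup>2)" by (simp add: complex_eq_iff Re_power2 Im_power2)
      then have "1 \<le> cmod (1 - w\<^sup>2)" by (simp only: norm_of_real) simp
      with w True show ?thesis by (auto simp: Sigma_m1_def)
    next
      case False
      with w show ?thesis by (auto simp: Sigma_m1_def)
    qed
  qed
  have "connected ?C" by (rule connected_connected_component)
  moreover have "z \<in> ?C" using \<open>z \<notin> Sigma_m1\<close> by simp
  ultimately have "?V \<inter> ?C = {}"
    using connectedD[OF _ opn disj cover] lt Re by blast
  with cover have "?C \<subseteq> ?U" by blast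
  moreover have "bounded ?U"
  proof (rule bounded_subset[OF bounded_ball[of 0 2]], safe)
    fix w assume w: "cmod (1 - w\<^sup>2) < 1"
    have "cmod (w\<^sup>2) \<le> cmod (1 - w\<^sup>2) + 1"
      using norm_triangle_ineq4[of 1 "1 - w\<^sup>2"] by simp
    with w have "(cmod w)\<^sup>2 < 2\<^sup>2" by (simp add: norm_power)
    then show "w \<in> ball 0 2" using power_less_imp_less_base[of "cmod w" 2 2] by simp
  qed
  ultimately have "bounded ?C" by (rule bounded_subset[rotated])
  with z show False by (simp add: outside_def)
qed

lemma gen_rem_coefficient_bound:
  assumes \<epsilon>: "0 < \<epsilon>"
  obtains C where "0 < C"
    "\<And>p m. p \<in> param_region \<epsilon> R \<Longrightarrow> 2 \<le> m \<Longrightarrow>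
       cmod ((deriv ^^ m) (gen_rem p) 0 / fact m) \<le> C / (real m * sqrt (real m))"
proof -
  let ?K = "param_region \<epsilon> R"
  obtain C F' F'' where T:
    "\<And>p x. p \<in> ?K \<Longrightarrow> x \<in> ball 0 1 \<Longrightarrow> (gen_rem p has_field_derivative F' p x) (at x)"
    "\<And>p x. p \<in> ?K \<Longrightarrow> x \<in> ball 0 1 \<Longrightarrow> (F' p has_field_derivative F'' p x) (at x)"
    "\<And>p x. p \<in> ?K \<Longrightarrow> x \<in> ball 0 1 \<Longrightarrow> cmod (gen_rem p x) \<le> C"
    "\<And>p x. p \<in> ?K \<Longrightarrow> x \<in> ball 0 1 \<Longrightarrow> cmod (F' p x) \<le> C * weight (1 - p\<^sup>2) x"
    "\<And>p x. p \<in> ?K \<Longrightarrow> x \<in> ball 0 1 \<Longrightarrow> cmod (F'' p x) \<le> C * weight (1 - p\<^sup>2) x ^ 3"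
    using tame_gen_rem[OF \<epsilon>, of R] by (rule tameE) (rule that)
  show ?thesis
  proof
    show "0 < 1728 * \<bar>C\<bar> + 1" by simp
    fix p :: complex and m :: nat
    assume p: "p \<in> ?K" and m: "2 \<le> m"
    have b: "1 \<le> cmod (1 - p\<^sup>2)" using p by (simp add: param_region_def)
    have "cmod (F'' p x) \<le> \<bar>C\<bar> * (inverse (sqrt (cmod (1 - x))) + inverse (sqrt (cmod (1 - x / (1 - p\<^sup>2))))) ^ 3"
      if "x \<in> ball 0 1" for x
    proof -
      have "0 \<le> weight (1 - p\<^sup>2) x ^ 3" using weight_ge_1[OF b that] by simp
      then have "C * weight (1 - p\<^sup>2) x ^ 3 \<le> \<bar>C\<bar> * weight (1 - p\<^sup>2) x ^ 3"
        by (intro mult_right_mono) auto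
      with T(5)[OF p that] show ?thesis unfolding weight_def by linarith
    qed
    from coefficient_bound_by_second_derivative[OF T(1,2)[OF p] _ b this m]
    have "cmod ((deriv ^^ m) (gen_rem p) 0 / fact m) \<le> 1728 * \<bar>C\<bar> / (real m * sqrt (real m))"
      by simp
    also have "\<dots> \<le> (1728 * \<bar>C\<bar> + 1) / (real m * sqrt (real m))"
      by (intro divide_right_mono) auto
    finally show "cmod ((deriv ^^ m) (gen_rem p) 0 / fact m) \<le> (1728 * \<bar>C\<bar> + 1) / (real m * sqrt (real m))" .
  qed
qed

lemma Omega_minus_subset:
  assumes \<epsilon>: "0 < \<epsilon>" and g: "admissible_arc \<epsilon> g"
  obtains R where "\<And>z. z \<in> Omega_minus \<epsilon> g - ball 0 \<epsilon> \<Longrightarrow> - z \<in> param_region \<epsilon> R"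
proof -
  have arc: "arc g" and ends: "pathstart g = \<i> * of_real \<epsilon>" "pathfinish g = - \<i> * of_real \<epsilon>"
    and neg: "\<And>t. t \<in> {0<..<1} \<Longrightarrow> Re (g t) < 0"
    using g by (auto simp: admissible_arc_def)
  have "compact (Sigma_r \<epsilon> g)"
    unfolding Sigma_r_def by (intro compact_Un compact_segment compact_path_image arc_imp_path arc)
  then have "bounded (inside (Sigma_r \<epsilon> g))"
    by (intro bounded_inside compact_imp_bounded)
  then obtain R where R: "\<And>z. z \<in> inside (Sigma_r \<epsilon> g) \<Longrightarrow> cmod z \<le> R"
    by (auto simp: bounded_iff)
  have left: "Sigma_r \<epsilon> g \<subseteq> {w. Re w \<le> 0}"
  proof -
    have "Re (g t) \<le> 0" if t: "t \<in> {0..1}" for t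
    proof -
      consider "t = 0" | "t = 1" | "t \<in> {0<..<1}" using t by fastforce
      then show ?thesis
        by cases (use ends neg[of t] in \<open>auto simp: pathstart_def pathfinish_def\<close>)
    qed
    then have "path_image g \<subseteq> {w. Re w \<le> 0}" by (auto simp: path_image_def)
    moreover have "closed_segment (- \<i> * of_real \<epsilon>) (\<i> * of_real \<epsilon>) \<subseteq> {w. Re w \<le> 0}"
      by (auto simp: closed_segment_def)
    ultimately show ?thesis by (simp add: Sigma_r_def)
  qed
  show ?thesis
  proof
    fix z assume z: "z \<in> Omega_minus \<epsilon> g - ball 0 \<epsilon>"
    then have ins: "z \<in> inside (Sigma_r \<epsilon> g)" and out: "z \<in> outside Sigma_m1"
      by (auto simp: Omega_minus_def)
    have "Re z < 0" using inside_subset_open_half_plane[OF left ins] .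
    then show "- z \<in> param_region \<epsilon> R"
      using z R[OF ins] outside_lemniscate[OF out] by (simp add: param_region_def)
  qed
qed

section \<open>The asymptotic formula\<close>

text \<open>
  In terms of \<open>s = csqrt p\<close>, \<open>u = csqrt (p - 1)\<close>, \<open>v = csqrt (1 + p)\<close> the prescribed branches
  are \<open>\<i> s\<close>, \<open>\<i> u\<close> and \<open>- v\<close>, so the prefactor is \<open>u / s\<close> and the second term of \<open>monic_P_expansion\<close> is the prefactor times
  \<open>sqrt 2 / (b\<^sup>m u v)\<close>.  Dividing the third term by the prefactor costs only \<open>\<bar>s\<bar> \<le> sqrt R\<close>, as \<open>\<bar>u v\<bar> = sqrt \<bar>b\<bar> \<ge> 1\<close>.
\<close>

theorem theorem1p3:
  shows "\<forall>\<delta>>0::real. \<exists>\<epsilon>>0. \<epsilon> < \<delta> \<and>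
    (\<forall>g. admissible_arc \<epsilon> g \<longrightarrow>
      (\<exists>r :: nat \<Rightarrow> complex \<Rightarrow> complex.
        (\<forall>m\<ge>1. \<forall>z \<in> Omega_minus \<epsilon> g - ball 0 \<epsilon>.
           monic_P m z = sqrt_1p z / sqrt_z z * (1 + z) ^ m *
             (1 - of_real (sqrt 2) * \<i> / ((1 - z\<^sup>2) ^ m * sqrt_1m z * sqrt_1p z) + r m z)) \<and>
        (\<exists>C>0::real. \<exists>M>0. \<forall>m\<ge>M. \<forall>z \<in> Omega_minus \<epsilon> g - ball 0 \<epsilon>.
           cmod (r m z) \<le> C / real m)))"
proof (intro allI impI)
  fix \<delta> :: real assume "0 < \<delta>"
  define \<epsilon> where "\<epsilon> = \<delta> / 2"
  have \<epsilon>: "0 < \<epsilon>" "\<epsilon> < \<delta>" using \<open>0 < \<delta>\<close> by (auto simp: \<epsilon>_def)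
  show "\<exists>\<epsilon>>0. \<epsilon> < \<delta> \<and>
    (\<forall>g. admissible_arc \<epsilon> g \<longrightarrow>
      (\<exists>r :: nat \<Rightarrow> complex \<Rightarrow> complex.
        (\<forall>m\<ge>1. \<forall>z \<in> Omega_minus \<epsilon> g - ball 0 \<epsilon>.
           monic_P m z = sqrt_1p z / sqrt_z z * (1 + z) ^ m *
             (1 - of_real (sqrt 2) * \<i> / ((1 - z\<^sup>2) ^ m * sqrt_1m z * sqrt_1p z) + r m z)) \<and>
        (\<exists>C>0::real. \<exists>M>0. \<forall>m\<ge>M. \<forall>z \<in> Omega_minus \<epsilon> g - ball 0 \<epsilon>.
           cmod (r m z) \<le> C / real m)))"
  proof (intro exI[of _ \<epsilon>] conjI allI impI \<epsilon>)
    fix g assume g: "admissible_arc \<epsilon> g"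
    obtain R where R: "\<And>z. z \<in> Omega_minus \<epsilon> g - ball 0 \<epsilon> \<Longrightarrow> - z \<in> param_region \<epsilon> R"
      using Omega_minus_subset[OF \<epsilon>(1) g] by blast
    obtain C where C: "0 < C" "\<And>p m. p \<in> param_region \<epsilon> R \<Longrightarrow> 2 \<le> m \<Longrightarrow>
        cmod ((deriv ^^ m) (gen_rem p) 0 / fact m) \<le> C / (real m * sqrt (real m))"
      using gen_rem_coefficient_bound[OF \<epsilon>(1), of R] by blast
    define r where "r m z = (deriv ^^ m) (gen_rem (- z)) 0 / fact m * csqrt (- z)
        / (csqrt (- z - 1) * csqrt (1 - z) * of_real (central_ratio m))" for m z
    show "\<exists>r. (\<forall>m\<ge>1. \<forall>z \<in> Omega_minus \<epsilon> g - ball 0 \<epsilon>.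
           monic_P m z = sqrt_1p z / sqrt_z z * (1 + z) ^ m *
             (1 - of_real (sqrt 2) * \<i> / ((1 - z\<^sup>2) ^ m * sqrt_1m z * sqrt_1p z) + r m z)) \<and>
        (\<exists>C>0::real. \<exists>M>0. \<forall>m\<ge>M. \<forall>z \<in> Omega_minus \<epsilon> g - ball 0 \<epsilon>.
           cmod (r m z) \<le> C / real m)"
    proof (intro exI[of _ r] conjI ballI allI impI)
      fix m z assume "z \<in> Omega_minus \<epsilon> g - ball 0 \<epsilon>"
      define p where "p = - z"
      have zp: "z = - p" by (simp add: p_def)
      have p: "0 < Re p" "1 \<le> cmod (1 - p\<^sup>2)"
        using R[OF \<open>z \<in> _\<close>] by (auto simp: p_def param_region_def)
      define s u v where "s = csqrt p" and "u = csqrt (p - 1)" and "v = csqrt (1 + p)"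
      have ps: "p = s\<^sup>2" by (simp add: s_def)
      have "1 - p\<^sup>2 \<noteq> 0" using p by auto
      then have nz: "s \<noteq> 0" "u \<noteq> 0" "v \<noteq> 0" "1 - p\<^sup>2 \<noteq> 0"
        using p(1) by (auto simp: s_def u_def v_def power2_eq_square add_eq_0_iff)
      have root2: "csqrt (2 * p) = of_real (sqrt 2) * s"
      proof (rule csqrt_unique)
        show "(of_real (sqrt 2) * s)\<^sup>2 = 2 * p"
          by (simp add: power_mult_distrib ps flip: of_real_power)
        have "0 < sqrt 2 * Re s" using Re_csqrt_pos[OF p(1)] by (simp add: s_def)
        then show "0 < Re (of_real (sqrt 2) * s) \<or> Re (of_real (sqrt 2) * s) = 0 \<and> 0 \<le> Im (of_real (sqrt 2) * s)"
          by simp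
      qed
      define \<rho> where "\<rho> = (deriv ^^ m) (gen_rem p) 0 / fact m"
      have c0: "of_real (central_ratio m) \<noteq> (0::complex)" using central_ratio_pos[of m] by simp
      have rmz: "r m z = \<rho> * s / (u * v * of_real (central_ratio m))"
        by (simp add: r_def zp \<rho>_def s_def u_def v_def)
      have "monic_P m z = (1 - p) ^ m * (s / (p / (u * v) * v) + of_real (sqrt 2) * s / (p * v * (1 - p\<^sup>2) ^ m)
          + \<rho> / (v * of_real (central_ratio m)))"
        unfolding zp monic_P_expansion[OF p] branch_sqrt_at_one[OF p] root2
        by (simp add: \<rho>_def s_def u_def v_def)
      also have "s / (p / (u * v) * v) = u / s"
        using nz by (simp add: ps power2_eq_square)
      also have "of_real (sqrt 2) * s / (p * v * (1 - p\<^sup>2) ^ m)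
          = u / s * (of_real (sqrt 2) / ((1 - p\<^sup>2) ^ m * v * u))"
        using nz by (simp add: ps power2_eq_square)
      also have "\<rho> / (v * of_real (central_ratio m)) = u / s * r m z"
        unfolding rmz using nz c0 by simp
      also have "of_real (sqrt 2) / ((1 - p\<^sup>2) ^ m * v * u)
          = - (of_real (sqrt 2) * \<i> / ((1 - p\<^sup>2) ^ m * (- v) * (\<i> * u)))"
        by simp
      finally show "monic_P m z = sqrt_1p z / sqrt_z z * (1 + z) ^ m *
          (1 - of_real (sqrt 2) * \<i> / ((1 - z\<^sup>2) ^ m * sqrt_1m z * sqrt_1p z) + r m z)"
        unfolding zp sqrt_1p_minus[OF p] sqrt_z_minus[OF p(1)] sqrt_1m_minus[OF p(1)]
        by (simp add: s_def u_def v_def distrib_left mult_ac)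
    next
      have "cmod (r m z) \<le> 2 * C * sqrt R / real m"
        if m: "2 \<le> m" and z: "z \<in> Omega_minus \<epsilon> g - ball 0 \<epsilon>" for m z
      proof -
        define p where "p = - z"
        have p: "cmod p \<le> R" "1 \<le> cmod (1 - p\<^sup>2)" "p \<in> param_region \<epsilon> R"
          using R[OF z] by (auto simp: p_def param_region_def)
        have "cmod (csqrt (p - 1) * csqrt (1 + p)) = sqrt (cmod ((p - 1) * (1 + p)))"
          by (simp add: norm_mult real_sqrt_mult)
        also have "(p - 1) * (1 + p) = - (1 - p\<^sup>2)" by (simp add: algebra_simps power2_eq_square)
        finally have uv: "1 \<le> cmod (csqrt (p - 1) * csqrt (1 + p))"
          using p(2) by (simp add: norm_minus_commute)
        then have uv_inv: "1 / cmod (csqrt (p - 1) * csqrt (1 + p)) \<le> 1"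
          by (subst divide_le_eq_1) linarith
        have R0: "0 \<le> R" using p(1) norm_ge_zero order_trans by blast
        have m0: "0 < real m" "0 < sqrt (real m)" using m by auto
        have "1 / (2 * sqrt (real m)) \<le> central_ratio m" using m by (intro central_ratio_lower_bound) simp
        then have c: "1 / central_ratio m \<le> 2 * sqrt (real m)"
          using m0 central_ratio_pos[of m] by (simp add: field_simps)
        have "cmod (r m z) = cmod ((deriv ^^ m) (gen_rem p) 0 / fact m) * sqrt (cmod p)
            * ((1 / cmod (csqrt (p - 1) * csqrt (1 + p))) * (1 / central_ratio m))"
          using central_ratio_pos[of m] by (simp add: r_def p_def norm_mult norm_divide)
        also have "\<dots> \<le> C / (real m * sqrt (real m)) * sqrt R * (1 * (2 * sqrt (real m)))"
          using C(2)[OF p(3) m] p(1) uv_inv c C(1) central_ratio_pos[of m] R0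
          by (intro mult_mono) auto
        also have "\<dots> = 2 * C * sqrt R / real m" using m0 by simp
        finally show ?thesis .
      qed
      moreover have "2 * C * sqrt R / real m \<le> (2 * C * sqrt \<bar>R\<bar> + 1) / real m" for m
        using C(1) by (intro divide_right_mono) (auto intro!: add_increasing2 mult_left_mono)
      ultimately have "\<forall>m\<ge>2. \<forall>z \<in> Omega_minus \<epsilon> g - ball 0 \<epsilon>. cmod (r m z) \<le> (2 * C * sqrt \<bar>R\<bar> + 1) / real m"
        by (meson order_trans)
      moreover have "0 < 2 * C * sqrt \<bar>R\<bar> + 1" using C(1) by (intro add_nonneg_pos) auto
      ultimately show "\<exists>C>0. \<exists>M>0. \<forall>m\<ge>M. \<forall>z \<in> Omega_minus \<epsilon> g - ball 0 \<epsilon>. cmod (r m z) \<le> C / real m"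
        by (metis pos2)
    qed
  qed
qed

end
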